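(* Let $0<\kappa<1$, let $\mathrm{rn}_2:\mathbb{R}\to\mathbb{R}$ be the function $\sin\tfrac12\psi$ defined in the context (for the modulus $\kappa$), and let $P=\wp(\bullet;G_2,G_3)$ be the Weierstrass function with invariants $$G_2=\tfrac1{12}(1+3\kappa^2)\quad\text{and}\quad G_3=\tfrac1{216}(1-9\kappa^2).$$ Then the function $\mathrm{rn}_2$ is given by $$\mathrm{rn}_2=\frac{\tfrac14\kappa P'}{(\tfrac14\kappa)^2-(\tfrac1{12}+P)^2}=\frac{\tfrac14\kappa P'}{(\tfrac14\kappa-\tfrac1{12}-P)(\tfrac14\kappa+\tfrac1{12}+P)},$$ where the right-hand side is regarded as a meromorphic function on $\mathbb{C}$ (removable singularities filled in) and the equality with $\mathrm{rn}_2$ holds on $\mathbb{R}$.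
   Context: $F(a,b;c;z)={}_2F_1(a,b;c;z)$ is the Gauss hypergeometric function. Fix the modulus $\kappa\in(0,1)$. The map $\mathbb{R}\to\mathbb{R}$, $T\mapsto\int_0^T F(\tfrac14,\tfrac34;\tfrac12;\kappa^2\sin^2 t)\,dt$, is an odd strictly increasing bijection; $\phi:\mathbb{R}\to\mathbb{R}$ denotes its inverse. Put $\psi=\arcsin(\kappa\sin\phi):\mathbb{R}\to(-\tfrac{\pi}{2},\tfrac{\pi}{2})$ and $\mathrm{rn}_2=\sin\tfrac12\psi:\mathbb{R}\to\mathbb{R}$. The Weierstrass function $\wp(\bullet;g_2,g_3)$ with invariants $g_2,g_3$ satisfies $(\wp')^2=4\wp^3-g_2\wp-g_3$ and has a double pole at $0$. *)

theory Defs
  imports "HOL-Complex_Analysis.Complex_Analysis"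
begin

definition hyp2F1 :: "real \<Rightarrow> real \<Rightarrow> real \<Rightarrow> real \<Rightarrow> real" where
  "hyp2F1 a b c z = eval_fps (fps_hypergeo [a, b] [c] 1) z"

lemma hyp2F1_altdef:
  "hyp2F1 a b c z =
     (\<Sum>n. pochhammer a n * pochhammer b n / (pochhammer c n * fact n) * z ^ n)"
  by (simp add: hyp2F1_def eval_fps_def)

text \<open>The interval integral is oriented, so it is odd in \<open>T\<close>. For \<open>0 < \<kappa> < 1\<close> the argument of
  the hypergeometric series lies in \<open>[0, \<kappa>\<^sup>2]\<close>, inside the disc of convergence.\<close>

definition amplitude_integral :: "real \<Rightarrow> real \<Rightarrow> real" where
  "amplitude_integral \<kappa> T =
     (LBINT t=ereal 0..ereal T. hyp2F1 (1/4) (3/4) (1/2) (\<kappa>\<^sup>2 * (sin t)\<^sup>2))"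

definition amplitude :: "real \<Rightarrow> real \<Rightarrow> real" where
  "amplitude \<kappa> = inv (amplitude_integral \<kappa>)"

definition mod_amplitude :: "real \<Rightarrow> real \<Rightarrow> real" where
  "mod_amplitude \<kappa> u = arcsin (\<kappa> * sin (amplitude \<kappa> u))"

definition rn2 :: "real \<Rightarrow> real \<Rightarrow> real" where
  "rn2 \<kappa> u = sin (mod_amplitude \<kappa> u / 2)"

text \<open>A meromorphic function on the plane is represented by a total function that is continuous
  away from its poles and takes the value 0 at them (\<^const>\<open>nicely_meromorphic_on\<close>); this makes the
  representing function unique. Among the meromorphic solutions of the differential equation the
  double pole at the origin singles out the Weierstrass function, since translates of it
  solve the same equation.\<close>

definition is_weierstrass_p :: "complex \<Rightarrow> complex \<Rightarrow> (complex \<Rightarrow> complex) \<Rightarrow> bool" where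
  "is_weierstrass_p g2 g3 P \<longleftrightarrow>
     P nicely_meromorphic_on UNIV \<and>
     is_pole P 0 \<and> zorder P 0 = -2 \<and>
     (\<forall>z. \<not> is_pole P z \<longrightarrow> (deriv P z)\<^sup>2 = 4 * P z ^ 3 - g2 * P z - g3)"

definition weierstrass_p :: "complex \<Rightarrow> complex \<Rightarrow> complex \<Rightarrow> complex" where
  "weierstrass_p g2 g3 = (THE P. is_weierstrass_p g2 g3 P)"

end

theory Submission
  imports Defs
begin

text \<open>
  Scale \<open>rn\<^sub>2\<close> to \<open>R = 2 rn\<^sub>2 / \<kappa>\<close> and put \<open>c = \<kappa>\<^sup>2/4\<close>. Everything rests on the differential equation
  \<open>y'\<^sup>2 = 1 - y\<^sup>2 + c y\<^sup>4\<close> with \<open>y(0) = 0\<close> and \<open>y'(0) = 1\<close>: both \<open>R\<close> and, near \<open>0\<close>, the quotient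
  \<open>Y = - P' / (2 ((P + 1/12)\<^sup>2 - c/4))\<close>, of which the right-hand side of the theorem is the
  multiple \<open>\<kappa> Y / 2\<close>, solve it.

  For \<open>R\<close> this comes from the closed form \<open>F(1/4, 3/4; 1/2; sin\<^sup>2 \<psi>) = cos (\<psi>/2) / cos \<psi>\<close>, the
  even part of a binomial series (\<open>hyp2F1_quarter_arcsin\<close>). It gives
  \<open>\<phi>' = cos \<psi> / cos (\<psi>/2)\<close> for the amplitude, hence \<open>R' = cos \<phi>\<close> by the chain rule, and the
  equation is \<open>cos\<^sup>2 \<phi> + sin\<^sup>2 \<phi> = 1\<close> in disguise. For \<open>Y\<close> it is algebra: with \<open>x = P + 1/12\<close> the
  Weierstrass cubic factors as \<open>(4 x - 1) (x\<^sup>2 - c/4)\<close>, so \<open>Y\<^sup>2\<close> and \<open>Y'\<close> are rational in \<open>x\<close>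
  (\<open>weierstrass_to_elliptic_ode\<close>); moreover \<open>P\<close> is recovered as \<open>(1 + Y') / (2 Y\<^sup>2) - 1/12\<close>.

  The equation has one local solution \<open>y\<close>, the inverse of an elliptic integral
  (\<open>elliptic_germ_exists\<close>, \<open>elliptic_germ_unique\<close>). Euler's argument shows that it satisfies the
  duplication formula \<open>y(2 a) = 2 y(a) y'(a) / (1 - c y(a)\<^sup>4)\<close> (\<open>elliptic_duplication\<close>). Read from
  right to left, this formula continues \<open>y\<close> from a disc to the disc of twice the radius, and so
  to a meromorphic function on the whole plane (\<open>elliptic_germ_extend\<close>).

  Three conclusions follow. The function \<open>(1 + Y') / (2 Y\<^sup>2) - 1/12\<close> built from this continuation
  is a Weierstrass function with the required invariants, and any Weierstrass function with these
  invariants agrees with it near \<open>0\<close> and hence everywhere; so \<open>P\<close> is well defined. Secondly,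
  \<open>Y\<close> is the continuation of \<open>y\<close>. Thirdly, \<open>R\<close> is \<open>Y\<close> on the real line: the two agree near \<open>0\<close>,
  both satisfy the duplication formula, and for \<open>R\<close> its denominator never vanishes, so that agreement
  and the absence of poles spread from a real interval to the interval twice as long
  (\<open>rn2_eq_extension\<close>).
\<close>


section \<open>Duplication and the local solution\<close>

text \<open>
  Euler's addition theorem on the line \<open>u + v = 2 a\<close>: along it
  \<open>(y(u) y'(v) + y(v) y'(u)) / (1 - c y(u)\<^sup>2 y(v)\<^sup>2)\<close> has derivative zero, by the equation of second
  order and its first integral. Its values at \<open>u = v = a\<close> and at \<open>u = 2 a\<close>, \<open>v = 0\<close> are the two
  sides. The field is left open because both the complex local solution and the real function
  \<open>2 rn\<^sub>2 / \<kappa>\<close> are doubled in this way.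
\<close>

lemma elliptic_duplication:
  fixes y p :: "'a::real_normed_field \<Rightarrow> 'a"
  assumes y: "\<And>z. z \<in> ball 0 r \<Longrightarrow> (y has_field_derivative p z) (at z)"
    and p: "\<And>z. z \<in> ball 0 r \<Longrightarrow> (p has_field_derivative 2 * c * y z ^ 3 - y z) (at z)"
    and eq: "\<And>z. z \<in> ball 0 r \<Longrightarrow> (p z)\<^sup>2 = 1 - (y z)\<^sup>2 + c * y z ^ 4"
    and nz: "\<And>z w. z \<in> ball 0 r \<Longrightarrow> w \<in> ball 0 r \<Longrightarrow> c * (y z)\<^sup>2 * (y w)\<^sup>2 \<noteq> 1"
    and init: "y 0 = 0" "p 0 = 1"
    and a: "2 * a \<in> ball 0 r"
  shows "y (2 * a) = 2 * y a * p a / (1 - c * y a ^ 4)"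
proof -
  define T where "T = ball (-a) r \<inter> ball a r"
  have T: "a + t \<in> ball 0 r" "a - t \<in> ball 0 r" if "t \<in> T" for t
    using that by (auto simp: T_def dist_norm norm_minus_commute)
  have a2: "norm a < r" using a norm_ge_zero[of a] norm_mult[of 2 a]
    unfolding mem_ball_0 norm_numeral by linarith
  have "- a - a = - (2 * a)" by simp
  hence "dist (-a) a = norm (2 * a)" by (metis dist_norm norm_minus_cancel)
  moreover have "0 < r" using a2 norm_ge_zero[of a] by linarith
  ultimately have "0 \<in> T" "a \<in> T" using a a2 by (simp_all add: T_def)
  define N where "N t = y (a + t) * p (a - t) + y (a - t) * p (a + t)" for t
  define D where "D t = 1 - c * (y (a + t))\<^sup>2 * (y (a - t))\<^sup>2" for t
  have Dnz: "D t \<noteq> 0" if "t \<in> T" for t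
    using nz[OF T[OF that]] by (auto simp: D_def)
  have deriv: "((\<lambda>t. N t / D t) has_field_derivative 0) (at t within T)" if "t \<in> T" for t
  proof -
    define u v where "u = a + t" and "v = a - t"
    have uv: "u \<in> ball 0 r" "v \<in> ball 0 r" using T[OF that] by (auto simp: u_def v_def)
    have dN: "(N has_field_derivative
         (y v * (2 * c * y u ^ 3 - y u) - y u * (2 * c * y v ^ 3 - y v))) (at t)"
      unfolding N_def
      by (rule derivative_eq_intros DERIV_chain2[where g = "\<lambda>t. a + t"] DERIV_chain2[where g = "\<lambda>t. a - t"] 
          y p uv[unfolded u_def v_def] refl)+ (simp add: u_def v_def algebra_simps)
    have dD: "(D has_field_derivative
         (- c * (2 * y u * p u * (y v)\<^sup>2 - 2 * (y u)\<^sup>2 * y v * p v))) (at t)"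
      unfolding D_def
      by (rule derivative_eq_intros DERIV_chain2[where g = "\<lambda>t. a + t"] DERIV_chain2[where g = "\<lambda>t. a - t"] 
          y p uv[unfolded u_def v_def] refl)+ (simp add: u_def v_def algebra_simps power2_eq_square)
    have "((\<lambda>t. N t / D t) has_field_derivative 0) (at t)"
    proof (rule DERIV_cong[OF DERIV_divide[OF dN dD Dnz[OF that]]])
      have "(y v * (2 * c * y u ^ 3 - y u) - y u * (2 * c * y v ^ 3 - y v)) * D t -
         N t * (- c * (2 * y u * p u * (y v)\<^sup>2 - 2 * (y u)\<^sup>2 * y v * p v)) = 0"
        using eq[OF uv(1)] eq[OF uv(2)] unfolding N_def D_def u_def[symmetric] v_def[symmetric]
        by algebra
      thus "((y v * (2 * c * y u ^ 3 - y u) - y u * (2 * c * y v ^ 3 - y v)) * D t -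
         N t * (- c * (2 * y u * p u * (y v)\<^sup>2 - 2 * (y u)\<^sup>2 * y v * p v))) / (D t * D t) = 0"
        by simp
    qed
    thus ?thesis by (rule DERIV_subset) auto
  qed
  have "convex T" unfolding T_def by (intro convex_Int convex_ball)
  from has_field_derivative_zero_constant[OF this deriv]
  obtain C where "\<And>t. t \<in> T \<Longrightarrow> N t / D t = C" by blast
  hence "N 0 / D 0 = N a / D a" using \<open>0 \<in> T\<close> \<open>a \<in> T\<close> by metis
  thus ?thesis
    by (simp add: N_def D_def init power2_eq_square power4_eq_xxxx mult.assoc flip: mult_2)
qed

text \<open>
  The derivative \<open>p\<close> is carried along explicitly, and the equation of second order is kept
  next to its first integral, since the latter loses information where \<open>p\<close> vanishes. The last
  conjunct says that the denominators of the addition theorem do not vanish.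
\<close>

definition elliptic_germ ::
  "complex \<Rightarrow> real \<Rightarrow> (complex \<Rightarrow> complex) \<Rightarrow> (complex \<Rightarrow> complex) \<Rightarrow> bool" where
  "elliptic_germ c r y p \<longleftrightarrow> r > 0 \<and> y 0 = 0 \<and> p 0 = 1 \<and>
     (\<forall>z\<in>ball 0 r. (y has_field_derivative p z) (at z) \<and>
        (p has_field_derivative 2 * c * y z ^ 3 - y z) (at z) \<and>
        (p z)\<^sup>2 = 1 - (y z)\<^sup>2 + c * y z ^ 4) \<and>
     (\<forall>z\<in>ball 0 r. \<forall>w\<in>ball 0 r. c * (y z)\<^sup>2 * (y w)\<^sup>2 \<noteq> 1)"

lemma elliptic_germ_duplication:
  assumes "elliptic_germ c r y p" and "2 * a \<in> ball 0 r"
  shows "y (2 * a) = 2 * y a * p a / (1 - c * y a ^ 4)"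
  using assms by (intro elliptic_duplication[of r y p c a]) (auto simp: elliptic_germ_def)

text \<open>
  The solution is the inverse function of the elliptic integral
  \<open>\<integral> dw / sqrt (1 - w\<^sup>2 + c w\<^sup>4)\<close>, taken on a disc in which the radicand stays in the right
  half plane.
\<close>

lemma elliptic_germ_exists:
  obtains r y p where "elliptic_germ c r y p"
proof -
  define q where "q w = 1 - w\<^sup>2 + c * w ^ 4" for w :: complex
  have contq: "continuous_on UNIV q" unfolding q_def by (intro continuous_intros)
  have "open (q -` ball 1 1)" using contq by (intro open_vimage) auto
  moreover have "0 \<in> q -` ball 1 1" by (simp add: q_def)
  ultimately obtain \<rho> where \<rho>: "\<rho> > 0" "ball 0 \<rho> \<subseteq> q -` ball 1 1"
    using open_contains_ball by blast
  have slit: "q w \<notin> \<real>\<^sub>\<le>\<^sub>0" "q w \<noteq> 0" if "w \<in> ball 0 \<rho>" for w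
  proof -
    have "norm (1 - q w) < 1" using that \<rho>(2) by (auto simp: dist_norm)
    hence "Re (1 - q w) < 1" using complex_Re_le_cmod[of "1 - q w"] by linarith
    thus "q w \<notin> \<real>\<^sub>\<le>\<^sub>0" "q w \<noteq> 0" by (auto simp: complex_nonpos_Reals_iff)
  qed
  have hol: "(\<lambda>w. 1 / csqrt (q w)) holomorphic_on ball 0 \<rho>"
    unfolding q_def using slit by (intro holomorphic_intros) (auto simp: q_def)
  obtain G0 where G0: "\<And>w. w \<in> ball 0 \<rho> \<Longrightarrow> (G0 has_field_derivative 1 / csqrt (q w)) (at w within ball 0 \<rho>)"
    using holomorphic_convex_primitive'[OF convex_ball open_ball hol] by blast
  define G where "G w = G0 w - G0 0" for w
  have G: "(G has_field_derivative 1 / csqrt (q w)) (at w)" if "w \<in> ball 0 \<rho>" for w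
    unfolding G_def using G0[OF that] that
    by (auto intro!: derivative_eq_intros simp: at_within_open[OF that])
  have [simp]: "G 0 = 0" by (simp add: G_def)
  have holG: "G holomorphic_on ball 0 \<rho>"
    unfolding holomorphic_on_open[OF open_ball] using G by blast
  have "deriv G 0 \<noteq> 0" using DERIV_imp_deriv[OF G[of 0]] \<rho>(1) by (simp add: q_def)
  note dnz = this
  have z0: "0 \<in> ball 0 \<rho>" using \<rho>(1) by simp
  obtain \<rho>1 where \<rho>1: "\<rho>1 > 0" "ball (0::complex) \<rho>1 \<subseteq> ball 0 \<rho>" "inj_on G (ball 0 \<rho>1)"
    by (rule has_complex_derivative_locally_injective[OF holG z0 open_ball dnz]) (rule that)
  have holG1: "G holomorphic_on ball 0 \<rho>1" using holG \<rho>1(2) holomorphic_on_subset by blast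
  obtain y where y: "y holomorphic_on G ` ball 0 \<rho>1"
     "\<And>w. w \<in> ball 0 \<rho>1 \<Longrightarrow> deriv G w * deriv y (G w) = 1"
     "\<And>w. w \<in> ball 0 \<rho>1 \<Longrightarrow> y (G w) = w"
    using holomorphic_has_inverse[OF holG1 open_ball \<rho>1(3)] by metis
  have op: "open (G ` ball 0 \<rho>1)" using open_mapping_thm3[OF holG1 open_ball \<rho>1(3)] .
  have y0: "y 0 = 0" using y(3)[of 0] \<rho>1(1) by simp
  have "0 \<in> G ` ball 0 \<rho>1" using \<rho>1(1) \<open>G 0 = 0\<close> by (metis centre_in_ball image_eqI)
  \<comment> \<open>Where \<open>\<bar>y\<bar>\<^sup>2 < K\<close>, the product \<open>c y(z)\<^sup>2 y(w)\<^sup>2\<close> stays inside the unit disc.\<close>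
  define K where "K = 1 / (norm c + 1)"
  have K: "K > 0" "K \<le> 1" "norm c * K < 1"
    by (auto simp: K_def divide_simps add_nonneg_pos)
  have "open (G ` ball 0 \<rho>1 \<inter> (\<lambda>z. norm (y z) ^ 2) -` {..<K})"
    using holomorphic_on_imp_continuous_on[OF y(1)] op
    by (intro continuous_open_preimage continuous_intros) auto
  moreover have "0 \<in> G ` ball 0 \<rho>1 \<inter> (\<lambda>z. norm (y z) ^ 2) -` {..<K}"
    using y0 \<open>0 \<in> G ` ball 0 \<rho>1\<close> K by simp
  ultimately obtain r where r: "r > 0" "ball 0 r \<subseteq> G ` ball 0 \<rho>1 \<inter> (\<lambda>z. norm (y z) ^ 2) -` {..<K}"
    using open_contains_ball by blast
  define p where "p z = csqrt (q (y z))" for z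
  have yim: "y z \<in> ball 0 \<rho>" if z: "z \<in> ball 0 r" for z
  proof -
    obtain w where w: "w \<in> ball 0 \<rho>1" "z = G w" using z r(2) by blast
    show ?thesis using y(3)[OF w(1)] w(2) subsetD[OF \<rho>1(2) w(1)] by simp
  qed
  have dy: "(y has_field_derivative p z) (at z)" if z: "z \<in> ball 0 r" for z
  proof -
    obtain w where w: "w \<in> ball 0 \<rho>1" "z = G w" using z r(2) by blast
    have w': "w \<in> ball 0 \<rho>" using subsetD[OF \<rho>1(2) w(1)] .
    have "deriv y z = p z"
      using y(2)[OF w(1)] y(3)[OF w(1)] w(2) slit(2)[OF w'] DERIV_imp_deriv[OF G[OF w']]
      by (simp add: p_def field_simps)
    moreover have "z \<in> G ` ball 0 \<rho>1" using w by blast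
    ultimately show ?thesis using holomorphic_derivI[OF y(1) op] by metis
  qed
  have dp: "(p has_field_derivative 2 * c * y z ^ 3 - y z) (at z)" if z: "z \<in> ball 0 r" for z
  proof -
    note s = slit[OF yim[OF z]]
    have "p z \<noteq> 0" using s by (simp add: p_def)
    have "((\<lambda>z. csqrt (q (y z))) has_field_derivative
       (4 * c * y z ^ 3 * p z - 2 * y z * p z) / (2 * csqrt (q (y z)))) (at z)"
    proof (rule DERIV_cong[OF DERIV_chain2[where f = csqrt and g = "\<lambda>z. q (y z)"]])
      show "((\<lambda>z. q (y z)) has_field_derivative (4 * c * y z ^ 3 * p z - 2 * y z * p z)) (at z)"
        unfolding q_def by (rule derivative_eq_intros dy z refl)+ (simp add: algebra_simps)
      show "(csqrt has_field_derivative 1 / (2 * csqrt (q (y z)))) (at (q (y z)))"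
        using has_field_derivative_csqrt[OF s(1)] by (simp add: field_simps)
    qed (simp add: field_simps)
    also have "(4 * c * y z ^ 3 * p z - 2 * y z * p z) / (2 * csqrt (q (y z))) = 2 * c * y z ^ 3 - y z"
      using \<open>p z \<noteq> 0\<close> by (simp add: p_def field_simps)
    finally show ?thesis by (simp add: p_def[abs_def])
  qed
  have nd: "c * (y z)\<^sup>2 * (y w)\<^sup>2 \<noteq> 1" if "z \<in> ball 0 r" "w \<in> ball 0 r" for z w
  proof -
    have "norm (y z) ^ 2 < K" "norm (y w) ^ 2 < K" using that r(2) by auto
    have "norm (c * (y z)\<^sup>2 * (y w)\<^sup>2) = norm c * norm (y z) ^ 2 * norm (y w) ^ 2"
      by (simp add: norm_mult norm_power)
    also have "\<dots> \<le> norm c * K * 1"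
      using \<open>norm (y z) ^ 2 < K\<close> \<open>norm (y w) ^ 2 < K\<close> K by (intro mult_mono) auto
    also have "\<dots> < 1" using K by simp
    finally show ?thesis by force
  qed
  have "elliptic_germ c r y p"
    unfolding elliptic_germ_def using r(1) y0 dy dp nd by (auto simp: p_def q_def)
  thus ?thesis by (rule that)
qed

text \<open>
  Composing a curve \<open>\<gamma>\<close> with the local inverse of \<open>y\<close> straightens it: the derivative of the
  composition is \<open>e\<close>, because two square roots of the same number with positive real part are
  equal. Curves are used so that a function of a real variable and a function holomorphic only off
  the origin can be compared with \<open>y\<close> in the same way; the origin itself then enters through
  continuity alone.
\<close>

lemma elliptic_germ_unique:
  assumes "elliptic_germ c r y p"
  obtains \<rho> where "\<rho> > 0"
    and "\<And>\<gamma> \<pi> e. norm e < \<rho> \<Longrightarrow> continuous_on {0..1} \<gamma> \<Longrightarrow> \<gamma> 0 = 0 \<Longrightarrow>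
           \<gamma> ` {0..1} \<subseteq> ball 0 \<rho> \<Longrightarrow>
           (\<And>t. t \<in> {0<..<1} \<Longrightarrow> (\<gamma> has_vector_derivative e * \<pi> t) (at t) \<and>
              (\<pi> t)\<^sup>2 = 1 - (\<gamma> t)\<^sup>2 + c * \<gamma> t ^ 4 \<and> Re (\<pi> t) > 0) \<Longrightarrow>
           \<gamma> (1::real) = y e"
proof -
  have germ: "r > 0" "y 0 = 0" "p 0 = 1"
    "\<And>z. z \<in> ball 0 r \<Longrightarrow> (y has_field_derivative p z) (at z)"
    "\<And>z. z \<in> ball 0 r \<Longrightarrow> (p has_field_derivative 2 * c * y z ^ 3 - y z) (at z)"
    "\<And>z. z \<in> ball 0 r \<Longrightarrow> (p z)\<^sup>2 = 1 - (y z)\<^sup>2 + c * y z ^ 4"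
    using assms by (auto simp: elliptic_germ_def)
  have "continuous_on (ball 0 r) p"
    using germ(5) by (meson DERIV_isCont continuous_at_imp_continuous_on)
  hence "open (ball 0 r \<inter> p -` {z. Re z > 0})"
    by (intro continuous_open_preimage open_halfspace_Re_gt) auto
  moreover have "0 \<in> ball 0 r \<inter> p -` {z. Re z > 0}" using germ by simp
  ultimately obtain r0 where r0: "r0 > 0" "ball 0 r0 \<subseteq> ball 0 r \<inter> p -` {z. Re z > 0}"
    using open_contains_ball by blast
  have hol0: "y holomorphic_on ball 0 r0"
    unfolding holomorphic_on_open[OF open_ball] using germ(4) r0(2) by blast
  have "deriv y 0 \<noteq> 0" using DERIV_imp_deriv[OF germ(4)[of 0]] germ(1,3) by simp
  note dnz = this
  have z0: "0 \<in> ball 0 r0" using r0(1) by simp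
  obtain r1 where r1: "r1 > 0" "ball (0::complex) r1 \<subseteq> ball 0 r0" "inj_on y (ball 0 r1)"
    by (rule has_complex_derivative_locally_injective[OF hol0 z0 open_ball dnz]) (rule that)
  have hol1: "y holomorphic_on ball 0 r1" using hol0 r1(2) holomorphic_on_subset by blast
  obtain G where G: "G holomorphic_on y ` ball 0 r1"
     "\<And>w. w \<in> ball 0 r1 \<Longrightarrow> deriv y w * deriv G (y w) = 1"
     "\<And>w. w \<in> ball 0 r1 \<Longrightarrow> G (y w) = w"
    using holomorphic_has_inverse[OF hol1 open_ball r1(3)] by metis
  have op: "open (y ` ball 0 r1)" using open_mapping_thm3[OF hol1 open_ball r1(3)] .
  have "0 \<in> y ` ball 0 r1" using r1(1) germ(2) by (metis centre_in_ball image_eqI)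
  then obtain \<rho> where \<rho>: "\<rho> > 0" "ball 0 \<rho> \<subseteq> y ` ball 0 r1"
    using op open_contains_ball by blast
  show ?thesis
  proof (rule that[of \<rho>])
    fix \<gamma> \<pi> :: "real \<Rightarrow> complex" and e
    assume cont: "continuous_on {0..1} \<gamma>" and 0: "\<gamma> 0 = 0" and im: "\<gamma> ` {0..1} \<subseteq> ball 0 \<rho>"
      and d: "\<And>t. t \<in> {0<..<1} \<Longrightarrow> (\<gamma> has_vector_derivative e * \<pi> t) (at t) \<and>
              (\<pi> t)\<^sup>2 = 1 - (\<gamma> t)\<^sup>2 + c * \<gamma> t ^ 4 \<and> Re (\<pi> t) > 0"
    have der: "((\<lambda>t. G (\<gamma> t) - of_real t * e) has_derivative (\<lambda>h. 0)) (at t within {0..1})"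
      if t: "t \<in> {0..1} - {0, 1}" for t
    proof -
      have "\<gamma> t \<in> ball 0 \<rho>" using t im by (meson DiffD1 image_subset_iff)
      then obtain z where z: "z \<in> ball 0 r1" "\<gamma> t = y z" using \<rho>(2) by blast
      have zr: "z \<in> ball 0 r" "Re (p z) > 0" using subsetD[OF r0(2) subsetD[OF r1(2) z(1)]] by auto
      have "(p z)\<^sup>2 = (\<pi> t)\<^sup>2" using d[of t] t z germ(6)[OF zr(1)] by simp
      hence "p z = \<pi> t \<or> p z = - \<pi> t" by (simp add: power2_eq_iff)
      hence pz: "p z = \<pi> t" using zr(2) d[of t] t by auto
      have "p z \<noteq> 0" using zr(2) by auto
      have "deriv G (\<gamma> t) = 1 / p z"
        using G(2)[OF z(1)] DERIV_imp_deriv[OF germ(4)[OF zr(1)]] z(2) \<open>p z \<noteq> 0\<close>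
        by (simp add: field_simps)
      moreover have "(G has_field_derivative deriv G (\<gamma> t)) (at (\<gamma> t))"
        using holomorphic_derivI[OF G(1) op] z by blast
      ultimately have "(G has_field_derivative 1 / p z) (at (\<gamma> t))" by simp
      with d[of t] t
      have "((G \<circ> \<gamma>) has_vector_derivative (e * \<pi> t) * (1 / p z)) (at t)"
        by (intro field_vector_diff_chain_at) auto
      hence "((\<lambda>t. G (\<gamma> t)) has_vector_derivative e) (at t)"
        using pz \<open>p z \<noteq> 0\<close> by (simp add: o_def)
      moreover have "((\<lambda>t. of_real t * e) has_vector_derivative e) (at t)"
        by (auto intro!: derivative_eq_intros)
      ultimately have "((\<lambda>t. G (\<gamma> t) - of_real t * e) has_vector_derivative e - e) (at t)"
        by (intro has_vector_derivative_diff)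
      thus ?thesis
        by (simp add: has_vector_derivative_def has_derivative_at_withinI)
    qed
    have "continuous_on (\<gamma> ` {0..1}) G"
      by (rule continuous_on_subset[OF holomorphic_on_imp_continuous_on[OF G(1)]])
         (rule order_trans[OF im \<rho>(2)])
    hence "continuous_on {0..1} (\<lambda>t. G (\<gamma> t))"
      using cont order_refl by (rule continuous_on_compose2)
    hence c: "continuous_on {0..1} (\<lambda>t. G (\<gamma> t) - of_real t * e)"
      by (intro continuous_intros)
    have "G 0 = 0" using G(3)[of 0] germ(2) r1(1) by simp
    hence start: "G (\<gamma> 0) - of_real 0 * e = 0" by (simp add: 0)
    have "finite {0, 1 :: real}" "(1::real) \<in> {0..1}" by simp_all
    from has_derivative_zero_unique_strong_interval[OF this(1) c start der this(2)]
    have "G (\<gamma> 1) - of_real 1 * e = 0" .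
    hence "G (\<gamma> 1) = e" by simp
    moreover have "\<gamma> 1 \<in> y ` ball 0 r1"
      by (rule subsetD[OF order_trans[OF im \<rho>(2)]]) simp
    ultimately show "\<gamma> 1 = y e" using G(3) by auto
  qed (rule \<rho>(1))
qed

section \<open>Meromorphic continuation\<close>

text \<open>
  The identity theorem for meromorphic functions, with equality up to isolated points.
\<close>

lemma meromorphic_eq_propagate:
  assumes f: "f meromorphic_on S" and g: "g meromorphic_on S" and S: "open S" "connected S"
    and z0: "z0 \<in> S" "eventually (\<lambda>z. f z = g z) (at z0)" and z: "z \<in> S"
  shows "eventually (\<lambda>w. f w = g w) (at z)"
proof -
  have "(\<lambda>w. f w - g w) meromorphic_on S"
    using f g by (intro meromorphic_intros)
  hence "(\<forall>\<^sub>\<approx>w\<in>S. f w - g w = 0) \<or> (\<forall>\<^sub>\<approx>w\<in>S. f w - g w \<noteq> 0)"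
    by (rule meromorphic_imp_constant_or_avoid) (use S in auto)
  moreover have False if "\<forall>\<^sub>\<approx>w\<in>S. f w - g w \<noteq> 0"
  proof -
    from that have "eventually (\<lambda>w. f w - g w \<noteq> 0) (at z0)"
      using z0(1) S(1) by (metis at_within_open eventually_cosparse_imp_eventually_at)
    with z0(2) have "eventually (\<lambda>_. False) (at z0)" by eventually_elim auto
    thus False by simp
  qed
  ultimately have "\<forall>\<^sub>\<approx>w\<in>S. f w - g w = 0" by blast
  hence "eventually (\<lambda>w. f w - g w = 0) (at z)"
    using z S(1) by (metis at_within_open eventually_cosparse_imp_eventually_at)
  thus ?thesis by simp
qed

lemma remove_sings_nicely_meromorphic_eq:
  assumes "f nicely_meromorphic_on A" "z \<in> A"
  shows "remove_sings f z = f z"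
  using assms unfolding nicely_meromorphic_on_def by auto

lemma nicely_meromorphic_eq_propagate:
  assumes "f nicely_meromorphic_on S" "g nicely_meromorphic_on S" "open S" "connected S"
    and "z0 \<in> S" "eventually (\<lambda>z. f z = g z) (at z0)" and "z \<in> S"
  shows "f z = g z"
proof -
  have "eventually (\<lambda>w. f w = g w) (at z)"
    using assms by (intro meromorphic_eq_propagate[of f S g z0 z]) (auto simp: nicely_meromorphic_on_def)
  hence "remove_sings f z = remove_sings g z" by (intro remove_sings_cong) auto
  thus ?thesis using assms by (simp add: remove_sings_nicely_meromorphic_eq)
qed

text \<open>
  Continuations to discs of growing radius agree with each other by the identity theorem, so at
  each point the value on the first disc that contains it may be taken.
\<close>

lemma meromorphic_extend_UNIV:
  assumes r: "r > 0"
    and ext: "\<And>n. \<exists>F. F nicely_meromorphic_on ball 0 (2 ^ n * r) \<and> (\<forall>z\<in>ball 0 r. F z = f z)"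
  shows "\<exists>F. F nicely_meromorphic_on UNIV \<and> (\<forall>z\<in>ball 0 r. F z = f z)"
proof -
  define R where "R n = 2 ^ n * r" for n :: nat
  have Rmono: "R m \<le> R n" if "m \<le> n" for m n
    using that r by (simp add: R_def)
  have Rpos: "R n > 0" for n using r by (simp add: R_def)
  obtain F where F: "\<And>n. F n nicely_meromorphic_on ball 0 (R n)"
      "\<And>n z. z \<in> ball 0 r \<Longrightarrow> F n z = f z"
    using ext unfolding R_def by metis
  have agree: "F m z = F n z" if z: "z \<in> ball 0 (R m)" and mn: "m \<le> n" for m n z
  proof (rule nicely_meromorphic_eq_propagate[of "F m" "ball 0 (R m)" "F n" 0 z])
    show "F n nicely_meromorphic_on ball 0 (R m)"
      using F(1)[of n] by (rule nicely_meromorphic_on_subset) (use Rmono[OF mn] in auto)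
    have "eventually (\<lambda>z. z \<in> ball 0 r) (at 0)"
      using r by (intro eventually_at_in_open') auto
    thus "\<forall>\<^sub>F z in at 0. F m z = F n z"
      by eventually_elim (simp only: F(2))
  qed (use F(1) Rpos z in auto)
  have ex: "\<exists>n. z \<in> ball 0 (R n)" for z :: complex
  proof -
    obtain n where "norm z / r < 2 ^ n" using real_arch_pow[of 2] by auto
    thus ?thesis using r by (auto simp: R_def field_simps)
  qed
  define H where "H z = F (LEAST n. z \<in> ball 0 (R n)) z" for z
  have H: "H z = F n z" if "z \<in> ball 0 (R n)" for z n
    unfolding H_def using that by (intro agree LeastI[of "\<lambda>n. z \<in> ball 0 (R n)"] Least_le)
  have "H nicely_meromorphic_on {z}" for z
  proof -
    obtain n where n: "z \<in> ball 0 (R n)" using ex by blast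
    have ev: "eventually (\<lambda>w. H w = F n w) (at z)"
      using eventually_at_in_open'[OF open_ball n] by eventually_elim (rule H)
    have "F n nicely_meromorphic_on {z}"
      using F(1)[of n] by (rule nicely_meromorphic_on_subset) (use n in auto)
    thus ?thesis
      using H[OF n] is_pole_cong[OF ev refl] tendsto_cong[OF ev] meromorphic_on_cong[of "{z}" H "F n" "{z}"] ev
      unfolding nicely_meromorphic_on_def by auto
  qed
  hence "H nicely_meromorphic_on UNIV"
    unfolding nicely_meromorphic_on_def by (subst meromorphic_on_meromorphic_at) auto
  moreover have "H z = f z" if "z \<in> ball 0 r" for z
    using H[of z 0] F(2)[OF that, of 0] that by (simp add: R_def)
  ultimately show ?thesis by blast
qed

text \<open>
  A pole is excluded because the function has the finite limit \<open>h z\<close>.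
\<close>

lemma nicely_meromorphic_isCont_eq:
  assumes f: "f nicely_meromorphic_on A" "z \<in> A"
    and h: "isCont h z" and ev: "eventually (\<lambda>w. f w = h w) (at z)"
  shows "f analytic_on {z}" and "f z = h z"
proof -
  have "h \<midarrow>z\<rightarrow> h z" using h by (simp add: isCont_def)
  hence lim: "f \<midarrow>z\<rightarrow> h z" using tendsto_cong[OF ev] by simp
  hence "\<not> is_pole f z"
    unfolding is_pole_def using not_tendsto_and_filterlim_at_infinity[of "at z" f "h z"] by auto
  thus "f analytic_on {z}" by (rule nicely_meromorphic_on_imp_analytic_at[OF f])
  hence "f \<midarrow>z\<rightarrow> f z" using analytic_at_imp_isCont isCont_def by blast
  thus "f z = h z" using lim by (rule LIM_unique)
qed

lemma eventually_eq_nhds_ball: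
  assumes "\<And>z. z \<in> ball a r \<Longrightarrow> f z = g z" and "z \<in> ball a r"
  shows "eventually (\<lambda>w. f w = g w) (nhds z)"
  using eventually_nhds_in_open[OF open_ball assms(2)] by eventually_elim (rule assms(1))

text \<open>
  The duplication formula in the form that defines a function at \<open>z\<close> from one at \<open>z / 2\<close>. It
  refers to \<open>F\<close> and its derivative only, so that it makes sense for any continuation of \<open>y\<close>.
\<close>

lemma elliptic_germ_half:
  assumes germ: "elliptic_germ c r y p" and F: "\<And>z. z \<in> ball 0 r \<Longrightarrow> F z = y z"
    and z: "z \<in> ball 0 r"
  shows "2 * F (z / 2) * deriv F (z / 2) / (1 - c * F (z / 2) ^ 4) = y z"
proof -
  have half: "z / 2 \<in> ball 0 r"
    using z norm_ge_zero[of z] by (simp add: norm_divide del: norm_ge_zero)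
  have "deriv F (z / 2) = deriv y (z / 2)"
    by (rule deriv_cong_ev[OF eventually_eq_nhds_ball[OF F half] refl])
  also have "\<dots> = p (z / 2)"
    using germ half by (intro DERIV_imp_deriv) (auto simp: elliptic_germ_def)
  finally show ?thesis
    using elliptic_germ_duplication[OF germ, of "z / 2"] z F[OF half] by simp
qed

lemma elliptic_germ_holomorphic:
  assumes "elliptic_germ c r y p"
  shows "y holomorphic_on ball 0 r"
  unfolding holomorphic_on_open[OF open_ball] using assms by (auto simp: elliptic_germ_def)

text \<open>
  Each application of the duplication formula doubles the radius of the disc on which \<open>y\<close> is
  defined; the price is that denominators may vanish, so only meromorphy survives.
\<close>

lemma elliptic_germ_extend:
  assumes germ: "elliptic_germ c r y p"
  obtains Y where "Y nicely_meromorphic_on UNIV" "\<forall>z\<in>ball 0 r. Y z = y z"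
proof -
  have r: "r > 0" using germ by (simp add: elliptic_germ_def)
  have an: "y analytic_on ball 0 r"
    using elliptic_germ_holomorphic[OF germ] by (simp add: analytic_on_open)
  have "\<exists>F. F nicely_meromorphic_on ball 0 (2 ^ n * r) \<and> (\<forall>z\<in>ball 0 r. F z = y z)" for n
  proof (induction n)
    case 0
    show ?case using analytic_on_imp_nicely_meromorphic_on[OF an] by auto
  next
    case (Suc n)
    then obtain F where F: "F nicely_meromorphic_on ball 0 (2 ^ n * r)"
      "\<And>z. z \<in> ball 0 r \<Longrightarrow> F z = y z" by blast
    define H where "H z = 2 * F (z / 2) * deriv F (z / 2) / (1 - c * F (z / 2) ^ 4)" for z
    have "F meromorphic_on ball 0 (2 ^ n * r)"
      using F(1) by (simp add: nicely_meromorphic_on_def)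
    hence "(\<lambda>w. 2 * F w * deriv F w / (1 - c * F w ^ 4)) meromorphic_on ball 0 (2 ^ n * r)"
      by (intro meromorphic_intros)
    hence "H meromorphic_on ball 0 (2 ^ Suc n * r)"
      unfolding H_def
      by (rule meromorphic_on_compose) (auto intro!: analytic_intros simp: norm_divide)
    hence "remove_sings H nicely_meromorphic_on ball 0 (2 ^ Suc n * r)"
      by (rule remove_sings_nicely_meromorphic)
    moreover have "remove_sings H z = y z" if z: "z \<in> ball 0 r" for z
    proof -
      have "H w = y w" if "w \<in> ball 0 r" for w
        unfolding H_def by (rule elliptic_germ_half[OF germ F(2) that])
      hence "eventually (\<lambda>w. H w = y w) (nhds z)"
        using z by (rule eventually_eq_nhds_ball)
      hence "eventually (\<lambda>w. H w = y w) (at z)"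
        by (simp add: eventually_at_filter eventually_mono)
      hence "remove_sings H z = remove_sings y z" by (rule remove_sings_cong) simp
      also have "\<dots> = y z"
        using an z by (intro remove_sings_at_analytic) (auto intro: analytic_on_subset)
      finally show ?thesis .
    qed
    ultimately show ?case by blast
  qed
  from meromorphic_extend_UNIV[OF r this] show ?thesis using that by blast
qed

lemma elliptic_extension_half:
  assumes germ: "elliptic_germ c r y p"
    and Y: "Y nicely_meromorphic_on UNIV" "\<And>z. z \<in> ball 0 r \<Longrightarrow> Y z = y z"
  shows "eventually (\<lambda>w. Y w = 2 * Y (w / 2) * deriv Y (w / 2) / (1 - c * Y (w / 2) ^ 4)) (at z)"
proof (rule meromorphic_eq_propagate[where S = UNIV and ?z0.0 = 0])
  show mero: "Y meromorphic_on UNIV" using Y(1) by (simp add: nicely_meromorphic_on_def)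
  hence "(\<lambda>w. 2 * Y w * deriv Y w / (1 - c * Y w ^ 4)) meromorphic_on UNIV"
    by (intro meromorphic_intros)
  thus "(\<lambda>w. 2 * Y (w / 2) * deriv Y (w / 2) / (1 - c * Y (w / 2) ^ 4)) meromorphic_on UNIV"
    by (rule meromorphic_on_compose) (auto intro!: analytic_intros)
  have "r > 0" using germ by (simp add: elliptic_germ_def)
  hence "eventually (\<lambda>z. z \<in> ball 0 r) (at 0)" by (intro eventually_at_in_open') auto
  thus "\<forall>\<^sub>F w in at 0. Y w = 2 * Y (w / 2) * deriv Y (w / 2) / (1 - c * Y (w / 2) ^ 4)"
    by eventually_elim (use elliptic_germ_half[OF germ Y(2)] Y(2) in simp)
qed auto


section \<open>The function rn2 on the real line\<close>

text \<open>
  By the duplication formulas for the Pochhammer symbol and the factorial, the coefficients are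
  those of even index in the binomial series of exponent \<open>-1/2\<close>.
\<close>

lemma hyp2F1_quarter_binomial:
  assumes "\<bar>z\<bar> < 1"
  shows "hyp2F1 (1/4) (3/4) (1/2) (z\<^sup>2) = ((1 + z) powr (-1/2) + (1 - z) powr (-1/2)) / 2"
proof -
  define a :: "nat \<Rightarrow> real" where "a n = (-1/2) gchoose n" for n
  have "(\<lambda>n. a n * z ^ n) sums (1 + z) powr (-1/2)"
    using gen_binomial_real[OF assms, of "-1/2"] by (simp add: a_def)
  moreover have "(\<lambda>n. a n * (-z) ^ n) sums (1 - z) powr (-1/2)"
    using gen_binomial_real[of "-z" "-1/2"] assms by (simp add: a_def)
  ultimately have "(\<lambda>n. (a n * z ^ n + a n * (-z) ^ n) / 2) sums
      (((1 + z) powr (-1/2) + (1 - z) powr (-1/2)) / 2)"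
    by (intro sums_divide sums_add)
  moreover have "(a n * z ^ n + a n * (-z) ^ n) / 2 = 0" if "n \<notin> range (\<lambda>m. 2 * m)" for n
  proof -
    have "odd n" using that by (auto elim!: evenE)
    thus ?thesis by simp
  qed
  ultimately have "(\<lambda>n. (a (2*n) * z ^ (2*n) + a (2*n) * (-z) ^ (2*n)) / 2) sums
      (((1 + z) powr (-1/2) + (1 - z) powr (-1/2)) / 2)"
    by (subst sums_mono_reindex[where g = "\<lambda>m. 2 * m"]) (auto simp: strict_mono_def)
  moreover have "(a (2*n) * z ^ (2*n) + a (2*n) * (-z) ^ (2*n)) / 2 =
      pochhammer (1/4) n * pochhammer (3/4) n / (pochhammer (1/2) n * fact n) * (z\<^sup>2) ^ n" for n
  proof -
    define X where "X = pochhammer (1/4) n * pochhammer (3/4) n / (pochhammer (1/2) n * fact n :: real)"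
    have "a (2*n) = pochhammer (2 * (1/4)) (2*n) / fact (2*n)"
      by (simp add: a_def gbinomial_pochhammer)
    also have "\<dots> = X"
      unfolding X_def pochhammer_double fact_double by simp
    finally have "a (2*n) = X" .
    moreover have "z ^ (2*n) = (z\<^sup>2) ^ n" "(-z) ^ (2*n) = (z\<^sup>2) ^ n" by (simp_all add: power_mult)
    ultimately show ?thesis unfolding X_def[symmetric] by simp
  qed
  ultimately show ?thesis unfolding hyp2F1_altdef by (simp add: sums_iff)
qed

text \<open>
  The half angle lies strictly within \<open>\<pi>/4\<close> of zero.
\<close>

lemma cos_half_arcsin_bounds:
  fixes z :: real
  assumes "\<bar>z\<bar> < 1"
  shows "\<bar>sin (arcsin z / 2)\<bar> < cos (arcsin z / 2)"
proof -
  define b where "b = arcsin z / 2"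
  have "-1 < z" "z < 1" using assms by auto
  from arcsin_lt_bounded[OF this] have "\<bar>arcsin z\<bar> < pi / 2" by arith
  hence "\<bar>b\<bar> < pi / 4" by (simp add: b_def)
  hence "cos b > 0" "cos (2 * b) > 0" by (auto intro!: cos_gt_zero_pi)
  hence "(sin b)\<^sup>2 < (cos b)\<^sup>2" by (simp add: cos_double)
  thus ?thesis using \<open>cos b > 0\<close>
    by (metis abs_of_pos b_def power2_less_imp_less power2_abs less_imp_le)
qed

text \<open>
  For \<open>z = sin (2 b)\<close> one has \<open>1 \<plusminus> z = (cos b \<plusminus> sin b)\<^sup>2\<close>, which turns the binomial form into
  a trigonometric one.
\<close>

lemma hyp2F1_quarter_arcsin:
  assumes "\<bar>z\<bar> < 1"
  shows "hyp2F1 (1/4) (3/4) (1/2) (z\<^sup>2) = cos (arcsin z / 2) / cos (arcsin z)"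
proof -
  define b where "b = arcsin z / 2"
  have cs: "\<bar>sin b\<bar> < cos b" using cos_half_arcsin_bounds[OF assms] by (simp add: b_def)
  have z: "z = 2 * sin b * cos b" using assms sin_double[of b] by (simp add: b_def)
  have 1: "1 = (sin b)\<^sup>2 + (cos b)\<^sup>2" by simp
  have "1 + z = (cos b + sin b)\<^sup>2" "1 - z = (cos b - sin b)\<^sup>2"
    unfolding z power2_sum power2_diff by (subst 1; simp)+
  hence "sqrt (1 + z) = cos b + sin b" "sqrt (1 - z) = cos b - sin b"
    using cs by auto
  moreover have "x powr (-1/2) = 1 / sqrt x" if "x > 0" for x :: real
    using that by (simp add: powr_minus_divide powr_half_sqrt flip: minus_divide_left)
  ultimately have "hyp2F1 (1/4) (3/4) (1/2) (z\<^sup>2) = (1 / (cos b + sin b) + 1 / (cos b - sin b)) / 2"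
    using assms by (subst hyp2F1_quarter_binomial) auto
  also have "\<dots> = cos b / ((cos b)\<^sup>2 - (sin b)\<^sup>2)"
  proof -
    have "cos b + sin b \<noteq> 0" "cos b - sin b \<noteq> 0" using cs by auto
    moreover have "(cos b)\<^sup>2 - (sin b)\<^sup>2 = (cos b + sin b) * (cos b - sin b)"
      by (simp add: power2_eq_square algebra_simps)
    ultimately show ?thesis by (simp add: add_frac_eq)
  qed
  also have "\<dots> = cos (arcsin z / 2) / cos (arcsin z)"
    using cos_double[of b] by (simp add: b_def)
  finally show ?thesis .
qed

context
  fixes \<kappa> :: real
  assumes \<kappa>: "0 < \<kappa>" "\<kappa> < 1"
begin

lemma abs_modulus_sin_less: "\<bar>\<kappa> * sin t\<bar> < 1"
proof -
  have "\<bar>\<kappa> * sin t\<bar> = \<kappa> * \<bar>sin t\<bar>" using \<kappa> by (simp add: abs_mult)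
  also have "\<dots> \<le> \<kappa> * 1" using \<kappa> by (intro mult_left_mono) auto
  finally show ?thesis using \<kappa> by simp
qed

lemma hyp2F1_integrand:
  "hyp2F1 (1/4) (3/4) (1/2) (\<kappa>\<^sup>2 * (sin t)\<^sup>2) =
     cos (arcsin (\<kappa> * sin t) / 2) / cos (arcsin (\<kappa> * sin t))"
  using hyp2F1_quarter_arcsin[OF abs_modulus_sin_less] by (simp add: power_mult_distrib)

lemma cos_arcsin_modulus_pos: "cos (arcsin (\<kappa> * sin t)) > 0"
  using arcsin_lt_bounded[of "\<kappa> * sin t"] abs_modulus_sin_less[of t]
  by (intro cos_gt_zero_pi) auto

lemma integrand_ge_1:
  "cos (arcsin (\<kappa> * sin t) / 2) / cos (arcsin (\<kappa> * sin t)) \<ge> 1"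
proof -
  define b where "b = arcsin (\<kappa> * sin t) / 2"
  have "cos b > 0" using cos_half_arcsin_bounds[OF abs_modulus_sin_less, of t] by (simp add: b_def)
  have "cos (2 * b) \<le> (cos b)\<^sup>2" by (simp add: cos_double)
  also have "\<dots> \<le> cos b" using \<open>cos b > 0\<close> by (simp add: power2_eq_square mult_left_le)
  finally show ?thesis using cos_arcsin_modulus_pos[of t] by (simp add: b_def)
qed

lemma amplitude_integral_deriv:
  "(amplitude_integral \<kappa> has_field_derivative
      cos (arcsin (\<kappa> * sin T) / 2) / cos (arcsin (\<kappa> * sin T))) (at T)"
proof -
  define h where "h t = cos (arcsin (\<kappa> * sin t) / 2) / cos (arcsin (\<kappa> * sin t))" for t
  define N where "N = \<bar>T\<bar> + 1"
  have "-1 \<le> \<kappa> * sin t" "\<kappa> * sin t \<le> 1" "cos (arcsin (\<kappa> * sin t)) \<noteq> 0" for t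
    using abs_modulus_sin_less[of t] cos_arcsin_modulus_pos[of t] by linarith+
  hence "continuous_on {-N..N} h"
    unfolding h_def by (intro continuous_intros) simp_all
  hence "((\<lambda>u. LBINT t=ereal 0..ereal u. h t) has_vector_derivative h T) (at T within {-N..N})"
    using interval_integral_FTC2[of "-N" 0 N h T] by (auto simp: N_def zero_ereal_def)
  moreover have "at T within {-N..N} = at T"
    by (rule at_within_interior) (auto simp: N_def)
  ultimately show ?thesis
    unfolding amplitude_integral_def[abs_def] hyp2F1_integrand
    by (simp add: has_real_derivative_iff_has_vector_derivative h_def)
qed

text \<open>
  Since the integrand is at least \<open>1\<close>, the integral does not contract distances. This gives
  injectivity and surjectivity at once.
\<close>

lemma amplitude_integral_expanding:
  assumes "s \<le> t"
  shows "t - s \<le> amplitude_integral \<kappa> t - amplitude_integral \<kappa> s"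
proof -
  have "amplitude_integral \<kappa> s - s \<le> amplitude_integral \<kappa> t - t"
  proof (rule DERIV_nonneg_imp_nondecreasing[OF assms])
    fix x
    show "\<exists>d. ((\<lambda>t. amplitude_integral \<kappa> t - t) has_real_derivative d) (at x) \<and> d \<ge> 0"
      using integrand_ge_1[of x]
      by (intro exI conjI) (rule derivative_eq_intros amplitude_integral_deriv refl | simp)+
  qed
  thus ?thesis by simp
qed

lemma amplitude_integral_0: "amplitude_integral \<kappa> 0 = 0"
  by (simp add: amplitude_integral_def)

lemma amplitude_integral_bij: "bij (amplitude_integral \<kappa>)"
proof (rule bijI)
  show "inj (amplitude_integral \<kappa>)"
  proof (rule injI)
    fix s t assume eq: "amplitude_integral \<kappa> s = amplitude_integral \<kappa> t"
    show "s = t"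
      using amplitude_integral_expanding[of s t] amplitude_integral_expanding[of t s] eq
      by linarith
  qed
  have "\<exists>t. amplitude_integral \<kappa> t = w" for w
  proof -
    have "amplitude_integral \<kappa> (min 0 w) \<le> w" "w \<le> amplitude_integral \<kappa> (max 0 w)"
      using amplitude_integral_expanding[of "min 0 w" 0] amplitude_integral_expanding[of 0 "max 0 w"]
        amplitude_integral_0 by auto
    moreover have "min 0 w \<le> max 0 w" by auto
    ultimately show ?thesis
      using IVT[of "amplitude_integral \<kappa>" "min 0 w" w "max 0 w"] DERIV_isCont[OF amplitude_integral_deriv]
      by blast
  qed
  thus "surj (amplitude_integral \<kappa>)" by (metis surjI)
qed

lemma amplitude_deriv:
  "(amplitude \<kappa> has_field_derivative
     cos (arcsin (\<kappa> * sin (amplitude \<kappa> u))) / cos (arcsin (\<kappa> * sin (amplitude \<kappa> u)) / 2)) (at u)"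
proof -
  define T where "T = amplitude \<kappa> u"
  have inv1: "amplitude_integral \<kappa> (amplitude \<kappa> v) = v" for v
    unfolding amplitude_def by (rule surj_f_inv_f[OF bij_is_surj[OF amplitude_integral_bij]])
  have inv2: "amplitude \<kappa> (amplitude_integral \<kappa> v) = v" for v
    unfolding amplitude_def by (rule inv_f_f[OF bij_is_inj[OF amplitude_integral_bij]])
  have "isCont (amplitude \<kappa>) (amplitude_integral \<kappa> T)"
    by (rule isCont_inverse_function[of 1]) (auto simp: inv2 DERIV_isCont[OF amplitude_integral_deriv])
  hence cont: "isCont (amplitude \<kappa>) u" by (simp add: T_def inv1)
  have "cos (arcsin (\<kappa> * sin T) / 2) / cos (arcsin (\<kappa> * sin T)) \<noteq> 0"
    using integrand_ge_1[of T] by auto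
  moreover have "(amplitude_integral \<kappa> has_field_derivative
      cos (arcsin (\<kappa> * sin T) / 2) / cos (arcsin (\<kappa> * sin T))) (at (amplitude \<kappa> u))"
    using amplitude_integral_deriv[of T] by (simp only: T_def)
  ultimately have "(amplitude \<kappa> has_field_derivative
      inverse (cos (arcsin (\<kappa> * sin T) / 2) / cos (arcsin (\<kappa> * sin T)))) (at u)"
    using DERIV_inverse_function[of "amplitude_integral \<kappa>" _ "amplitude \<kappa>" u "u - 1" "u + 1"] cont inv1
    by (metis diff_less_eq less_add_one)
  thus ?thesis by (simp add: T_def)
qed

lemma amplitude_0: "amplitude \<kappa> 0 = 0"
  unfolding amplitude_def by (metis amplitude_integral_0 inv_f_f bij_is_inj[OF amplitude_integral_bij])

lemma rn2_deriv:
  "(rn2 \<kappa> has_field_derivative \<kappa> / 2 * cos (amplitude \<kappa> u)) (at u)"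
proof -
  define a where "a = arcsin (\<kappa> * sin (amplitude \<kappa> u))"
  note lt = abs_modulus_sin_less[of "amplitude \<kappa> u"]
  have "cos a > 0" "cos (a / 2) > 0"
    using cos_arcsin_modulus_pos[of "amplitude \<kappa> u"] cos_half_arcsin_bounds[OF lt] by (auto simp: a_def)
  have "cos a = sqrt (1 - (\<kappa> * sin (amplitude \<kappa> u))\<^sup>2)"
    unfolding a_def using lt by (intro cos_arcsin) auto
  hence da: "(arcsin has_field_derivative inverse (cos a)) (at (\<kappa> * sin (amplitude \<kappa> u)))"
    using lt DERIV_arcsin[of "\<kappa> * sin (amplitude \<kappa> u)"] by auto
  have "((\<lambda>u. \<kappa> * sin (amplitude \<kappa> u)) has_field_derivative
      \<kappa> * (cos (amplitude \<kappa> u) * (cos a / cos (a / 2)))) (at u)"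
    unfolding a_def by (rule derivative_eq_intros amplitude_deriv refl)+ simp
  from DERIV_chain2[where f = arcsin and g = "\<lambda>u. \<kappa> * sin (amplitude \<kappa> u)", OF da this]
  have da2: "((\<lambda>u. mod_amplitude \<kappa> u / 2) has_field_derivative
      inverse (cos a) * (\<kappa> * (cos (amplitude \<kappa> u) * (cos a / cos (a / 2)))) / 2) (at u)"
    unfolding mod_amplitude_def by (rule DERIV_cdivide)
  have "(rn2 \<kappa> has_field_derivative
      cos (a / 2) * (inverse (cos a) * (\<kappa> * (cos (amplitude \<kappa> u) * (cos a / cos (a / 2)))) / 2)) (at u)"
    unfolding rn2_def[abs_def] using DERIV_chain2[OF DERIV_sin da2]
    by (simp add: a_def mod_amplitude_def)
  also have "cos (a / 2) * (inverse (cos a) * (\<kappa> * (cos (amplitude \<kappa> u) * (cos a / cos (a / 2)))) / 2)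
     = \<kappa> / 2 * cos (amplitude \<kappa> u)"
    using \<open>cos a > 0\<close> \<open>cos (a/2) > 0\<close> by (simp add: field_simps)
  finally show ?thesis .
qed

lemma sin_amplitude_rn2:
  "\<kappa> * sin (amplitude \<kappa> u) = 2 * rn2 \<kappa> u * cos (mod_amplitude \<kappa> u / 2)"
  using sin_double[of "mod_amplitude \<kappa> u / 2"] abs_modulus_sin_less[of "amplitude \<kappa> u"]
  by (simp add: rn2_def mod_amplitude_def)

text \<open>
  This is \<open>sin\<^sup>2 + cos\<^sup>2 = 1\<close> for the amplitude, with \<open>\<kappa> sin \<phi> = sin \<psi>\<close> expressed through
  the half angle.
\<close>

lemma rn2_first_integral:
  "(\<kappa> * cos (amplitude \<kappa> u))\<^sup>2 = \<kappa>\<^sup>2 - 4 * (rn2 \<kappa> u)\<^sup>2 + 4 * rn2 \<kappa> u ^ 4"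
proof -
  have "(\<kappa> * cos (amplitude \<kappa> u))\<^sup>2 = \<kappa>\<^sup>2 - (\<kappa> * sin (amplitude \<kappa> u))\<^sup>2"
    by (simp add: power_mult_distrib cos_squared_eq algebra_simps)
  also have "\<dots> = \<kappa>\<^sup>2 - 4 * (rn2 \<kappa> u)\<^sup>2 * (1 - (rn2 \<kappa> u)\<^sup>2)"
    unfolding sin_amplitude_rn2 by (simp add: power_mult_distrib cos_squared_eq rn2_def)
  finally show ?thesis by (simp add: algebra_simps power2_eq_square power4_eq_xxxx)
qed

lemma cos_amplitude_deriv:
  "((\<lambda>u. cos (amplitude \<kappa> u)) has_field_derivative
      - (2 / \<kappa>) * rn2 \<kappa> u * (1 - 2 * (rn2 \<kappa> u)\<^sup>2)) (at u)"
proof -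
  define a where "a = mod_amplitude \<kappa> u"
  have "cos (a / 2) > 0"
    using cos_half_arcsin_bounds[OF abs_modulus_sin_less, of "amplitude \<kappa> u"]
    by (auto simp: a_def mod_amplitude_def)
  have "((\<lambda>u. cos (amplitude \<kappa> u)) has_field_derivative
      - sin (amplitude \<kappa> u) * (cos a / cos (a / 2))) (at u)"
    unfolding a_def mod_amplitude_def
    by (rule derivative_eq_intros amplitude_deriv refl)+
  also have "sin (amplitude \<kappa> u) = 2 / \<kappa> * rn2 \<kappa> u * cos (a / 2)"
    using sin_amplitude_rn2[of u] \<kappa> by (simp add: a_def field_simps)
  also have "cos a = 1 - 2 * (rn2 \<kappa> u)\<^sup>2"
    using cos_double_sin[of "a / 2"] by (simp add: rn2_def a_def)
  also have "- (2 / \<kappa> * rn2 \<kappa> u * cos (a / 2)) * ((1 - 2 * (rn2 \<kappa> u)\<^sup>2) / cos (a / 2)) =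
      - (2 / \<kappa>) * rn2 \<kappa> u * (1 - 2 * (rn2 \<kappa> u)\<^sup>2)"
    using \<open>cos (a / 2) > 0\<close> by simp
  finally show ?thesis .
qed

text \<open>
  With \<open>s = rn\<^sub>2\<^sup>2\<close>, the first integral gives \<open>4 s (1 - s) \<le> \<kappa>\<^sup>2\<close>, and \<open>s \<le> 1/2\<close> because \<open>\<psi>/2\<close> lies
  within \<open>\<pi>/4\<close> of zero.
\<close>

lemma rn2_square_bound: "2 * (rn2 \<kappa> u)\<^sup>2 \<le> \<kappa>\<^sup>2"
proof -
  define s where "s = (rn2 \<kappa> u)\<^sup>2"
  have "\<bar>rn2 \<kappa> u\<bar> < cos (mod_amplitude \<kappa> u / 2)"
    using cos_half_arcsin_bounds[OF abs_modulus_sin_less, of "amplitude \<kappa> u"]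
    by (simp add: rn2_def mod_amplitude_def)
  hence "s < (cos (mod_amplitude \<kappa> u / 2))\<^sup>2"
    unfolding s_def by (metis abs_ge_zero power2_abs power_strict_mono zero_less_numeral)
  hence "s \<le> 1 / 2" by (simp add: cos_squared_eq s_def rn2_def)
  have "0 \<le> \<kappa>\<^sup>2 - 4 * s + 4 * s\<^sup>2"
    using rn2_first_integral[of u] zero_le_power2[of "\<kappa> * cos (amplitude \<kappa> u)"] by (simp add: s_def)
  moreover have "s * s \<le> s * (1/2)" using \<open>s \<le> 1/2\<close> by (intro mult_left_mono) (auto simp: s_def)
  ultimately have "2 * s \<le> \<kappa>\<^sup>2" unfolding power2_eq_square[of s] by linarith
  thus ?thesis by (simp add: s_def)
qed

end

lemma rn2_0:
  assumes "0 < \<kappa>" "\<kappa> < 1"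
  shows "rn2 \<kappa> 0 = 0"
  by (simp add: rn2_def mod_amplitude_def amplitude_0[OF assms])

text \<open>
  By the bound on \<open>rn\<^sub>2\<^sup>2\<close> the product is at most \<open>\<kappa>\<^sup>2 < 1\<close>. So the denominators of the
  duplication formula do not vanish on the real line, and doubling creates no poles there.
\<close>

lemma rn2_denominator:
  assumes \<kappa>: "0 < \<kappa>" "\<kappa> < 1"
  shows "\<kappa>\<^sup>2 / 4 * (2 / \<kappa> * rn2 \<kappa> u)\<^sup>2 * (2 / \<kappa> * rn2 \<kappa> v)\<^sup>2 \<noteq> 1"
proof -
  have "\<kappa>\<^sup>2 / 4 * (2 / \<kappa> * rn2 \<kappa> u)\<^sup>2 * (2 / \<kappa> * rn2 \<kappa> v)\<^sup>2 =
      (2 * (rn2 \<kappa> u)\<^sup>2) * (2 * (rn2 \<kappa> v)\<^sup>2) / \<kappa>\<^sup>2"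
    using \<kappa> by (simp add: field_simps)
  also have "\<dots> \<le> \<kappa>\<^sup>2 * \<kappa>\<^sup>2 / \<kappa>\<^sup>2"
    using rn2_square_bound[OF \<kappa>] by (intro divide_right_mono mult_mono) auto
  also have "\<dots> = \<kappa>\<^sup>2" using \<kappa> by (simp add: power2_eq_square)
  also have "\<dots> < 1" using \<kappa> by (simp add: power_less_one_iff)
  finally show ?thesis by simp
qed

lemma rn2_scaled_deriv:
  assumes \<kappa>: "0 < \<kappa>" "\<kappa> < 1"
  shows "((\<lambda>u. 2 / \<kappa> * rn2 \<kappa> u) has_field_derivative cos (amplitude \<kappa> u)) (at u)"
  by (rule DERIV_cong[OF DERIV_cmult[OF rn2_deriv[OF \<kappa>]]]) (use \<kappa> in simp)

lemma rn2_scaled_first_integral: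
  assumes \<kappa>: "0 < \<kappa>" "\<kappa> < 1"
  shows "(cos (amplitude \<kappa> u))\<^sup>2 =
     1 - (2 / \<kappa> * rn2 \<kappa> u)\<^sup>2 + \<kappa>\<^sup>2 / 4 * (2 / \<kappa> * rn2 \<kappa> u) ^ 4"
proof -
  define R where "R = 2 / \<kappa> * rn2 \<kappa> u"
  have "2 * rn2 \<kappa> u = \<kappa> * R" using \<kappa> by (simp add: R_def)
  with rn2_first_integral[OF \<kappa>, of u]
  have "4 * (\<kappa>\<^sup>2 * (cos (amplitude \<kappa> u))\<^sup>2) = \<kappa>\<^sup>2 * (4 - 4 * R\<^sup>2 + \<kappa>\<^sup>2 * R ^ 4)"
    by algebra
  also have "\<dots> = 4 * (\<kappa>\<^sup>2 * (1 - R\<^sup>2 + \<kappa>\<^sup>2 / 4 * R ^ 4))"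
    by (simp add: algebra_simps)
  finally show ?thesis using \<kappa> by (simp add: R_def)
qed

lemma rn2_scaled_duplication:
  assumes \<kappa>: "0 < \<kappa>" "\<kappa> < 1"
  defines "R \<equiv> \<lambda>u. 2 / \<kappa> * rn2 \<kappa> u"
  shows "R (2 * a) = 2 * R a * cos (amplitude \<kappa> a) / (1 - \<kappa>\<^sup>2 / 4 * R a ^ 4)"
proof (rule elliptic_duplication[where r = "\<bar>2 * a\<bar> + 1"])
  fix z
  show "(R has_field_derivative cos (amplitude \<kappa> z)) (at z)"
    unfolding R_def by (rule rn2_scaled_deriv[OF \<kappa>])
  show "((\<lambda>u. cos (amplitude \<kappa> u)) has_field_derivative 2 * (\<kappa>\<^sup>2 / 4) * R z ^ 3 - R z) (at z)"
    by (rule DERIV_cong[OF cos_amplitude_deriv[OF \<kappa>]])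
       (use \<kappa> in \<open>simp add: R_def field_simps power2_eq_square power3_eq_cube\<close>)
  show "(cos (amplitude \<kappa> z))\<^sup>2 = 1 - (R z)\<^sup>2 + \<kappa>\<^sup>2 / 4 * R z ^ 4"
    unfolding R_def by (rule rn2_scaled_first_integral[OF \<kappa>])
  fix w
  show "\<kappa>\<^sup>2 / 4 * (R z)\<^sup>2 * (R w)\<^sup>2 \<noteq> 1"
    unfolding R_def by (rule rn2_denominator[OF \<kappa>])
qed (auto simp: R_def rn2_0[OF \<kappa>] amplitude_0[OF \<kappa>])

text \<open>
  For small \<open>u\<close> the curve \<open>t \<mapsto> R (t u)\<close> satisfies the hypotheses of local uniqueness.
\<close>

lemma rn2_eq_germ:
  assumes \<kappa>: "0 < \<kappa>" "\<kappa> < 1" and germ: "elliptic_germ (of_real (\<kappa>\<^sup>2 / 4)) r y p"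
  obtains \<epsilon> where "\<epsilon> > 0" "\<And>u. \<bar>u\<bar> < \<epsilon> \<Longrightarrow> y (of_real u) = of_real (2 / \<kappa> * rn2 \<kappa> u)"
proof -
  define R where "R u = 2 / \<kappa> * rn2 \<kappa> u" for u
  obtain \<rho> where \<rho>: "\<rho> > 0"
    and uniq: "\<And>\<gamma> \<pi> e. norm e < \<rho> \<Longrightarrow> continuous_on {0..1} \<gamma> \<Longrightarrow> \<gamma> 0 = 0 \<Longrightarrow>
           \<gamma> ` {0..1} \<subseteq> ball 0 \<rho> \<Longrightarrow>
           (\<And>t. t \<in> {0<..<1} \<Longrightarrow> (\<gamma> has_vector_derivative e * \<pi> t) (at t) \<and>
              (\<pi> t)\<^sup>2 = 1 - (\<gamma> t)\<^sup>2 + of_real (\<kappa>\<^sup>2 / 4) * \<gamma> t ^ 4 \<and> Re (\<pi> t) > 0) \<Longrightarrow>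
           \<gamma> (1::real) = y e"
    using elliptic_germ_unique[OF germ] by blast
  have dR: "(R has_field_derivative cos (amplitude \<kappa> u)) (at u)" for u
    unfolding R_def by (rule rn2_scaled_deriv[OF \<kappa>])
  have "isCont R 0" "isCont (\<lambda>u. cos (amplitude \<kappa> u)) 0"
    by (rule DERIV_isCont[OF dR] DERIV_isCont[OF cos_amplitude_deriv[OF \<kappa>]])+
  moreover have "R 0 = 0" "amplitude \<kappa> 0 = 0"
    by (simp_all add: R_def rn2_0[OF \<kappa>] amplitude_0[OF \<kappa>])
  ultimately have "R \<midarrow>0\<rightarrow> 0" "(\<lambda>u. cos (amplitude \<kappa> u)) \<midarrow>0\<rightarrow> 1"
    by (simp_all add: isCont_def)
  hence "eventually (\<lambda>u. \<bar>R u\<bar> < \<rho>) (at 0)" "eventually (\<lambda>u. cos (amplitude \<kappa> u) > 0) (at 0)"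
    using \<rho> tendstoD[of R 0 "at 0" \<rho>] order_tendstoD(1)[of "\<lambda>u. cos (amplitude \<kappa> u)" 1 "at 0" 0] by (auto simp: dist_norm)
  hence "eventually (\<lambda>u. \<bar>R u\<bar> < \<rho> \<and> cos (amplitude \<kappa> u) > 0) (at 0)" by (rule eventually_conj)
  then obtain \<delta> where \<delta>: "\<delta> > 0" "\<And>u. u \<noteq> 0 \<Longrightarrow> \<bar>u\<bar> < \<delta> \<Longrightarrow> \<bar>R u\<bar> < \<rho> \<and> cos (amplitude \<kappa> u) > 0"
    unfolding eventually_at by (auto simp: dist_norm)
  have \<delta>': "\<bar>R u\<bar> < \<rho>" "cos (amplitude \<kappa> u) > 0" if "\<bar>u\<bar> < \<delta>" for u
    using \<delta>(2)[of u] that \<rho> \<open>R 0 = 0\<close> \<open>amplitude \<kappa> 0 = 0\<close> by (cases "u = 0"; simp)+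
  show ?thesis
  proof (rule that[of "min \<delta> \<rho>"])
    fix u assume u: "\<bar>u\<bar> < min \<delta> \<rho>"
    have small: "\<bar>t * u\<bar> < \<delta>" if "t \<in> {0..1}" for t
      using that u mult_right_mono[of t 1 "\<bar>u\<bar>"] by (auto simp: abs_mult)
    have dg: "((\<lambda>t. complex_of_real (R (t * u))) has_vector_derivative
         of_real u * of_real (cos (amplitude \<kappa> (t * u)))) (at t)" for t
    proof -
      have "((\<lambda>t. R (t * u)) has_field_derivative cos (amplitude \<kappa> (t * u)) * u) (at t)"
        by (rule DERIV_chain2[OF dR]) (auto intro!: derivative_eq_intros)
      from has_vector_derivative_of_real[OF this] show ?thesis by (simp add: mult.commute)
    qed
    have "complex_of_real (R (1 * u)) = y (of_real u)"
    proof (rule uniq[where \<gamma> = "\<lambda>t. of_real (R (t * u))" and \<pi> = "\<lambda>t. of_real (cos (amplitude \<kappa> (t * u)))"])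
      show "norm (complex_of_real u) < \<rho>" using u by simp
      show "continuous_on {0..1} (\<lambda>t. complex_of_real (R (t * u)))"
        using has_vector_derivative_continuous[OF dg] continuous_at_imp_continuous_on by blast
      show "complex_of_real (R (0 * u)) = 0" using \<open>R 0 = 0\<close> by simp
      show "(\<lambda>t. complex_of_real (R (t * u))) ` {0..1} \<subseteq> ball 0 \<rho>"
        using \<delta>'(1)[OF small] by auto
      fix t :: real assume t: "t \<in> {0<..<1}"
      have "(complex_of_real (cos (amplitude \<kappa> (t * u))))\<^sup>2 =
        of_real ((cos (amplitude \<kappa> (t * u)))\<^sup>2)" by simp
      also have "\<dots> = 1 - (complex_of_real (R (t * u)))\<^sup>2 +
           complex_of_real (\<kappa>\<^sup>2 / 4) * complex_of_real (R (t * u)) ^ 4"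
        unfolding rn2_scaled_first_integral[OF \<kappa>] R_def by simp
      finally show "((\<lambda>t. complex_of_real (R (t * u))) has_vector_derivative
         of_real u * of_real (cos (amplitude \<kappa> (t * u)))) (at t) \<and>
         (complex_of_real (cos (amplitude \<kappa> (t * u))))\<^sup>2 = 1 - (complex_of_real (R (t * u)))\<^sup>2 +
           complex_of_real (\<kappa>\<^sup>2 / 4) * complex_of_real (R (t * u)) ^ 4 \<and>
         Re (complex_of_real (cos (amplitude \<kappa> (t * u)))) > 0"
        using dg \<delta>'(2)[OF small, of t] t by simp
    qed
    thus "y (of_real u) = of_real (2 / \<kappa> * rn2 \<kappa> u)" by (simp add: R_def)
  qed (use \<delta> \<rho> in simp)
qed

text \<open>
  By induction on \<open>n\<close> the claim holds for \<open>\<bar>u\<bar> < 2\<^sup>n \<epsilon>\<close>: at \<open>u / 2\<close> both the values and the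
  derivatives agree, so \<open>Y\<close> near \<open>u\<close> equals an expression continuous at \<open>u\<close> whose value there
  is given by the duplication formula for \<open>R\<close>.
\<close>

lemma rn2_eq_extension:
  assumes \<kappa>: "0 < \<kappa>" "\<kappa> < 1" and germ: "elliptic_germ (of_real (\<kappa>\<^sup>2 / 4)) r y p"
    and Y1: "Y nicely_meromorphic_on UNIV" and Y2: "\<forall>z\<in>ball 0 r. Y z = y z"
  shows "Y analytic_on {of_real u}" and "Y (of_real u) = of_real (2 / \<kappa> * rn2 \<kappa> u)"
proof -
  note Y = Y1 Y2[rule_format]
  define R where "R u = 2 / \<kappa> * rn2 \<kappa> u" for u
  define c where "c = \<kappa>\<^sup>2 / 4"
  obtain \<epsilon>0 where \<epsilon>0: "\<epsilon>0 > 0" "\<And>u. \<bar>u\<bar> < \<epsilon>0 \<Longrightarrow> y (of_real u) = of_real (R u)"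
    using rn2_eq_germ[OF \<kappa> germ] unfolding R_def by blast
  define \<epsilon> where "\<epsilon> = min \<epsilon>0 r"
  have "r > 0" using germ by (simp add: elliptic_germ_def)
  hence \<epsilon>: "\<epsilon> > 0" using \<epsilon>0(1) by (simp add: \<epsilon>_def)
  have step: "Y analytic_on {of_real u} \<and> Y (of_real u) = of_real (R u)" if "\<bar>u\<bar> < 2 ^ n * \<epsilon>" for n u
    using that
  proof (induction n arbitrary: u)
    case 0
    hence u: "complex_of_real u \<in> ball 0 r" "\<bar>u\<bar> < \<epsilon>0" by (auto simp: \<epsilon>_def)
    have "\<forall>\<^sub>F w in nhds (of_real u). Y w = y w"
      by (rule eventually_eq_nhds_ball[OF Y(2) u(1)])
    moreover have "y analytic_on {of_real u}"
      using elliptic_germ_holomorphic[OF germ] u(1) analytic_at by blast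
    ultimately have "Y analytic_on {of_real u}"
      using analytic_at_cong by blast
    thus ?case using Y(2)[OF u(1)] \<epsilon>0(2)[OF u(2)] by simp
  next
    case (Suc n)
    define v where "v = u / 2"
    have v: "\<bar>v\<bar> < 2 ^ n * \<epsilon>" using Suc.prems by (simp add: v_def)
    have Yv: "Y analytic_on {of_real v}" "Y (of_real v) = of_real (R v)" using Suc.IH[OF v] by auto
    have dY: "deriv Y (of_real v) = of_real (cos (amplitude \<kappa> v))"
    proof (rule vector_derivative_unique_at)
      have "(Y has_field_derivative deriv Y (of_real v)) (at (of_real v))"
        using analytic_derivI[OF Yv(1)] .
      from has_vector_derivative_real_field[OF this]
      have "((\<lambda>t. Y (of_real t)) has_vector_derivative deriv Y (of_real v)) (at v)" .
      thus "((\<lambda>t. of_real (R t)) has_vector_derivative deriv Y (of_real v)) (at v)"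
        by (rule has_vector_derivative_transform_within_open[where S = "{- (2 ^ n * \<epsilon>)<..<2 ^ n * \<epsilon>}"])
           (use v Suc.IH in \<open>auto simp: abs_less_iff\<close>)
      show "((\<lambda>t. complex_of_real (R t)) has_vector_derivative of_real (cos (amplitude \<kappa> v))) (at v)"
        unfolding R_def by (rule has_vector_derivative_of_real[OF rn2_scaled_deriv[OF \<kappa>]])
    qed
    have "c * (R v)\<^sup>2 * (R v)\<^sup>2 \<noteq> 1"
      unfolding c_def R_def by (rule rn2_denominator[OF \<kappa>])
    hence "1 - c * R v ^ 4 \<noteq> 0" by (simp add: power2_eq_square power4_eq_xxxx mult.assoc)
    hence nz: "1 - of_real c * Y (of_real v) ^ 4 \<noteq> 0"
      unfolding Yv(2) by (metis of_real_1 of_real_diff of_real_eq_0_iff of_real_mult of_real_power)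
    define H where "H w = 2 * Y (w / 2) * deriv Y (w / 2) / (1 - of_real c * Y (w / 2) ^ 4)" for w
    have cont: "isCont Y (of_real u / 2)" "isCont (deriv Y) (of_real u / 2)"
      using analytic_at_imp_isCont[OF Yv(1)] analytic_at_imp_isCont[OF analytic_deriv[OF Yv(1)]]
      by (simp_all add: v_def)
    have "isCont (\<lambda>w. w / 2) (complex_of_real u)" by (intro continuous_intros) simp
    from isCont_o2[OF this cont(1)] isCont_o2[OF this cont(2)]
    have "isCont H (of_real u)"
      unfolding H_def using nz by (intro continuous_intros) (auto simp: v_def)
    moreover have "\<forall>\<^sub>F w in at (of_real u). Y w = H w"
      unfolding H_def c_def by (rule elliptic_extension_half[OF germ Y])
    ultimately have "Y analytic_on {of_real u}" "Y (of_real u) = H (of_real u)"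
      using nicely_meromorphic_isCont_eq[OF Y(1) UNIV_I] by blast+
    moreover have "H (of_real u) = of_real (2 * R v * cos (amplitude \<kappa> v) / (1 - c * R v ^ 4))"
      using dY Yv(2) by (simp add: H_def v_def)
    moreover have "2 * R v * cos (amplitude \<kappa> v) / (1 - c * R v ^ 4) = R u"
      using rn2_scaled_duplication[OF \<kappa>, of v] by (simp add: R_def c_def v_def)
    ultimately show ?case by simp
  qed
  obtain n where "\<bar>u\<bar> / \<epsilon> < 2 ^ n" using real_arch_pow[of 2] by auto
  hence "\<bar>u\<bar> < 2 ^ n * \<epsilon>" using \<epsilon> by (simp add: field_simps)
  from step[OF this] show "Y analytic_on {of_real u}" "Y (of_real u) = of_real (2 / \<kappa> * rn2 \<kappa> u)"
    by (auto simp: R_def)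
qed

section \<open>The Weierstrass function and its relation to the local solution\<close>

text \<open>
  The inverse transformation is \<open>P = (1 + y') / (2 y\<^sup>2) - 1/12\<close>.
\<close>

definition weierstrass_to_elliptic :: "complex \<Rightarrow> (complex \<Rightarrow> complex) \<Rightarrow> complex \<Rightarrow> complex" where
  "weierstrass_to_elliptic c P z = - deriv P z / (2 * ((P z + 1/12)\<^sup>2 - c / 4))"

text \<open>
  The shift by \<open>1/12\<close> moves a root of the cubic to \<open>1/4\<close> and the other two to
  \<open>\<plusminus> sqrt c / 2\<close>; it explains the shape of the invariants.
\<close>

lemma weierstrass_cubic_factor:
  fixes x c :: complex
  shows "4 * (x - 1/12) ^ 3 - (1 + 12 * c) / 12 * (x - 1/12) - (1 - 36 * c) / 216 =
    (4 * x - 1) * (x\<^sup>2 - c / 4)"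
  by (simp add: field_simps power2_eq_square power3_eq_cube)

text \<open>
  With \<open>P'\<^sup>2 = (4 x - 1) m\<close> and its derivative \<open>P'' = 2 m + x (4 x - 1)\<close>, the square and the derivative of
  \<open>Y = - P' / (2 m)\<close> are rational functions of \<open>x\<close>, and every claim is an identity
  between such functions.
\<close>

lemma weierstrass_to_elliptic_ode:
  fixes c :: complex and P :: "complex \<Rightarrow> complex"
  defines "Y \<equiv> weierstrass_to_elliptic c P"
  assumes W: "is_weierstrass_p ((1 + 12 * c) / 12) ((1 - 36 * c) / 216) P"
    and an: "P analytic_on {z}" and x: "x = P z + 1/12" and m: "m = x\<^sup>2 - c / 4"
    and nz: "4 * x - 1 \<noteq> 0" "m \<noteq> 0"
    and q: "q = (2 * x\<^sup>2 + c / 2 - x) / (2 * m)"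
  shows "(Y has_field_derivative q) (at z)"
    and "q\<^sup>2 = 1 - (Y z)\<^sup>2 + c * Y z ^ 4"
    and "Y z \<noteq> 0"
    and "P z = (1 + q) / (2 * (Y z)\<^sup>2) - 1/12"
    and "(Y z)\<^sup>2 = (4 * x - 1) / (4 * m)"
proof -
  let ?g2 = "(1 + 12 * c) / 12" and ?g3 = "(1 - 36 * c) / 216"
  obtain A where A: "open A" "z \<in> A" "P holomorphic_on A" using an analytic_at by blast
  have ode: "(deriv P w)\<^sup>2 = 4 * P w ^ 3 - ?g2 * P w - ?g3" if "w \<in> A" for w
  proof -
    have "\<not> is_pole P w" using not_is_pole_holomorphic[OF A(1) that A(3)] .
    thus ?thesis using W by (auto simp: is_weierstrass_p_def)
  qed
  have Px: "P z = x - 1/12" by (simp add: x)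
  have sq: "(deriv P z)\<^sup>2 = (4 * x - 1) * m"
    unfolding ode[OF A(2)] Px m by (rule weierstrass_cubic_factor)
  hence P'nz: "deriv P z \<noteq> 0" using nz by auto
  have d1: "(P has_field_derivative deriv P w) (at w)" if "w \<in> A" for w
    using holomorphic_derivI[OF A(3,1) that] .
  have d2: "(deriv P has_field_derivative deriv (deriv P) z) (at z)"
    using holomorphic_derivI[OF holomorphic_deriv[OF A(3,1)] A(1,2)] .
  have "((\<lambda>w. (deriv P w)\<^sup>2) has_field_derivative (2 * deriv P z * deriv (deriv P) z)) (at z)"
    by (rule derivative_eq_intros d2 refl)+ simp
  moreover have "((\<lambda>w. (deriv P w)\<^sup>2) has_field_derivative (12 * P z ^ 2 - ?g2) * deriv P z) (at z)"
  proof (rule has_field_derivative_transform_within_open[OF _ A(1,2)])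
    show "((\<lambda>w. 4 * P w ^ 3 - ?g2 * P w - ?g3) has_field_derivative (12 * P z ^ 2 - ?g2) * deriv P z) (at z)"
      by (rule derivative_eq_intros d1[OF A(2)] refl)+ (simp add: algebra_simps)
  qed (simp add: ode)
  ultimately have "2 * deriv P z * deriv (deriv P) z = (12 * P z ^ 2 - ?g2) * deriv P z"
    by (rule DERIV_unique)
  hence "deriv P z * (2 * deriv (deriv P) z - (12 * P z ^ 2 - ?g2)) = 0"
    by (simp add: algebra_simps)
  hence "2 * deriv (deriv P) z = 12 * P z ^ 2 - ?g2" using P'nz by simp
  hence P'': "deriv (deriv P) z = 2 * m + x * (4 * x - 1)"
  proof -
    have "12 * (x - 1/12)\<^sup>2 - ?g2 = 12 * x\<^sup>2 - 2 * x - c"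
      by (simp add: field_simps power2_eq_square)
    with \<open>2 * deriv (deriv P) z = _\<close> have "2 * deriv (deriv P) z = 12 * x\<^sup>2 - 2 * x - c"
      by (simp only: Px)
    thus ?thesis using m by algebra
  qed
  have Yz: "Y z = - deriv P z / (2 * m)" by (simp add: Y_def weierstrass_to_elliptic_def m x)
  have "(Y has_field_derivative
     ((- deriv (deriv P) z) * (2 * m) - (- deriv P z) * (2 * (2 * x * deriv P z))) / ((2 * m) * (2 * m))) (at z)"
  proof -
    have "((\<lambda>w. 2 * ((P w + 1/12)\<^sup>2 - c / 4)) has_field_derivative 2 * (2 * x * deriv P z)) (at z)"
      by (rule derivative_eq_intros d1[OF A(2)] refl)+ (simp add: x)
    moreover have "2 * ((P z + 1/12)\<^sup>2 - c / 4) \<noteq> 0" using nz(2) unfolding m x by (simp add: mult.commute)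
    ultimately show ?thesis
      unfolding Y_def weierstrass_to_elliptic_def[abs_def] m x
      by (rule DERIV_divide[OF DERIV_minus[OF d2]])
  qed
  also have "(- deriv (deriv P) z) * (2 * m) - (- deriv P z) * (2 * (2 * x * deriv P z)) =
      2 * m * (2 * x\<^sup>2 + c / 2 - x)"
    using sq P'' m by algebra
  also have "2 * m * (2 * x\<^sup>2 + c / 2 - x) / ((2 * m) * (2 * m)) = q"
    unfolding q by (rule nonzero_mult_divide_mult_cancel_left) (use nz(2) in simp)
  finally show "(Y has_field_derivative q) (at z)" .
  show "Y z \<noteq> 0" using Yz P'nz nz(2) by simp
  show Y2: "(Y z)\<^sup>2 = (4 * x - 1) / (4 * m)"
    unfolding Yz using sq nz(2) by (simp add: power_divide power_mult_distrib power2_eq_square)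
  have qm: "2 * m * q = 2 * x\<^sup>2 + c / 2 - x" using nz(2) by (simp add: q)
  have Ym: "4 * m * (Y z)\<^sup>2 = 4 * x - 1" using nz(2) Y2 by simp
  have "4 * m\<^sup>2 * (q\<^sup>2 - (1 - (Y z)\<^sup>2 + c * Y z ^ 4)) = 0"
    using qm Ym m by algebra
  thus "q\<^sup>2 = 1 - (Y z)\<^sup>2 + c * Y z ^ 4" using nz(2) by simp
  have "2 * m * (1 + q - 2 * (Y z)\<^sup>2 * x) = 0" using qm Ym m by algebra
  hence "1 + q = 2 * (Y z)\<^sup>2 * x" using nz(2) by simp
  thus "P z = (1 + q) / (2 * (Y z)\<^sup>2) - 1/12"
    using \<open>Y z \<noteq> 0\<close> by (simp add: x)
qed

text \<open>
  As \<open>z \<rightarrow> 0\<close>, \<open>x\<close> tends to infinity, whence \<open>Y \<rightarrow> 0\<close> and \<open>Y' \<rightarrow> 1\<close>; local uniqueness along the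
  segments from \<open>0\<close> to \<open>z\<close> identifies \<open>Y\<close> with \<open>y\<close>. In particular the values of \<open>P\<close> near \<open>0\<close> are
  determined by the invariants.
\<close>

lemma weierstrass_to_elliptic_eq_germ:
  assumes W: "is_weierstrass_p ((1 + 12 * c) / 12) ((1 - 36 * c) / 216) P"
    and germ: "elliptic_germ c r y p"
  shows "eventually (\<lambda>z. y z = weierstrass_to_elliptic c P z \<and>
            P z = (1 + p z) / (2 * (y z)\<^sup>2) - 1/12) (at 0)"
proof -
  define Y where "Y = weierstrass_to_elliptic c P"
  define x where "x z = P z + 1/12" for z
  define m where "m z = (x z)\<^sup>2 - c / 4" for z
  define q where "q z = (2 * (x z)\<^sup>2 + c / 2 - x z) / (2 * m z)" for z
  obtain \<rho> where \<rho>: "\<rho> > 0"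
    and uniq: "\<And>\<gamma> \<pi> e. norm e < \<rho> \<Longrightarrow> continuous_on {0..1} \<gamma> \<Longrightarrow> \<gamma> 0 = 0 \<Longrightarrow>
           \<gamma> ` {0..1} \<subseteq> ball 0 \<rho> \<Longrightarrow>
           (\<And>t. t \<in> {0<..<1} \<Longrightarrow> (\<gamma> has_vector_derivative e * \<pi> t) (at t) \<and>
              (\<pi> t)\<^sup>2 = 1 - (\<gamma> t)\<^sup>2 + c * \<gamma> t ^ 4 \<and> Re (\<pi> t) > 0) \<Longrightarrow>
           \<gamma> (1::real) = y e"
    using elliptic_germ_unique[OF germ] by blast
  have mero: "P meromorphic_on UNIV" and pole: "is_pole P 0"
    using W by (auto simp: is_weierstrass_p_def nicely_meromorphic_on_def)
  have an: "eventually (\<lambda>z. P analytic_on {z}) (at 0)"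
    using meromorphic_on_imp_analytic_cosparse[OF mero]
    by (rule eventually_cosparse_imp_eventually_at) auto
  have lim: "filterlim x at_infinity (at 0)"
    unfolding x_def using pole unfolding is_pole_def
    by (rule tendsto_add_filterlim_at_infinity') (rule tendsto_const)
  \<comment> \<open>In terms of \<open>w = 1/x\<close>, the rational functions of \<open>x\<close> at infinity become continuous at \<open>0\<close>.\<close>
  define w where "w z = inverse (x z)" for z
  have w0: "(w \<longlongrightarrow> 0) (at 0)"
    unfolding w_def using tendsto_inverse_0 lim by (rule filterlim_compose)
  have xnz: "eventually (\<lambda>z. x z \<noteq> 0) (at 0)" "eventually (\<lambda>z. x z \<noteq> 1/4) (at 0)"
    by (rule filterlim_at_infinity_imp_eventually_ne[OF lim])+
  have den: "((\<lambda>z. 1 - c * (w z)\<^sup>2 / 4) \<longlongrightarrow> 1 - c * 0\<^sup>2 / 4) (at 0)"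
    using w0 by (intro tendsto_intros) auto
  hence den_nz: "eventually (\<lambda>z. 1 - c * (w z)\<^sup>2 / 4 \<noteq> 0) (at 0)"
    by (rule tendsto_imp_eventually_ne) simp
  have factor: "m z = (x z)\<^sup>2 * (1 - c * (w z)\<^sup>2 / 4)" if "x z \<noteq> 0" for z
    using that by (simp add: m_def w_def field_simps)
  have mnz: "eventually (\<lambda>z. m z \<noteq> 0) (at 0)"
    using xnz(1) den_nz by eventually_elim (simp add: factor)
  have "((\<lambda>z. (2 + c * (w z)\<^sup>2 / 2 - w z) / (2 * (1 - c * (w z)\<^sup>2 / 4))) \<longlongrightarrow>
      (2 + c * 0\<^sup>2 / 2 - 0) / (2 * (1 - c * 0\<^sup>2 / 4))) (at 0)"
    using w0 by (intro tendsto_intros) auto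
  moreover have "eventually (\<lambda>z. (2 + c * (w z)\<^sup>2 / 2 - w z) / (2 * (1 - c * (w z)\<^sup>2 / 4)) = q z) (at 0)"
    using xnz(1) den_nz
  proof eventually_elim
    case (elim z)
    have "2 * (x z)\<^sup>2 + c / 2 - x z = (x z)\<^sup>2 * (2 + c * (w z)\<^sup>2 / 2 - w z)"
      using elim(1) by (simp add: w_def field_simps power2_eq_square)
    thus ?case using elim by (simp add: q_def factor)
  qed
  ultimately have "(q \<longlongrightarrow> 1) (at 0)" by (simp add: tendsto_cong)
  hence "((\<lambda>z. Re (q z)) \<longlongrightarrow> Re 1) (at 0)" by (rule tendsto_Re)
  hence qpos: "eventually (\<lambda>z. Re (q z) > 0) (at 0)"
    using order_tendstoD(1)[of "\<lambda>z. Re (q z)" "Re 1" "at 0" 0] by simp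
  have "((\<lambda>z. (4 * w z - (w z)\<^sup>2) / (4 * (1 - c * (w z)\<^sup>2 / 4))) \<longlongrightarrow>
      (4 * 0 - 0\<^sup>2) / (4 * (1 - c * 0\<^sup>2 / 4))) (at 0)"
    using w0 by (intro tendsto_intros) auto
  moreover have "eventually (\<lambda>z. (4 * w z - (w z)\<^sup>2) / (4 * (1 - c * (w z)\<^sup>2 / 4)) = (Y z)\<^sup>2) (at 0)"
    using xnz den_nz mnz an
  proof eventually_elim
    case (elim z)
    have "(Y z)\<^sup>2 = (4 * x z - 1) / (4 * m z)"
      unfolding Y_def
      by (rule weierstrass_to_elliptic_ode(5)[OF W elim(5) x_def m_def _ elim(4) refl])
         (use elim(2) in \<open>auto simp: field_simps\<close>)
    moreover have "4 * x z - 1 = (x z)\<^sup>2 * (4 * w z - (w z)\<^sup>2)"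
      using elim(1) by (simp add: w_def field_simps power2_eq_square)
    ultimately show ?case using elim(1,3) by (simp add: factor)
  qed
  ultimately have "((\<lambda>z. (Y z)\<^sup>2) \<longlongrightarrow> 0) (at 0)" by (simp add: tendsto_cong)
  hence "((\<lambda>z. sqrt (norm ((Y z)\<^sup>2))) \<longlongrightarrow> sqrt (norm (0::complex))) (at 0)"
    by (intro tendsto_intros)
  hence Y0: "(Y \<longlongrightarrow> 0) (at 0)" by (simp add: norm_power tendsto_norm_zero_iff)
  hence Ysmall: "eventually (\<lambda>z. norm (Y z) < \<rho>) (at 0)"
    using tendstoD[OF Y0 \<rho>] by simp
  have "eventually (\<lambda>z. P analytic_on {z} \<and> x z \<noteq> 1/4 \<and> m z \<noteq> 0 \<and> Re (q z) > 0 \<and> norm (Y z) < \<rho>) (at 0)"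
    using an xnz(2) mnz qpos Ysmall by eventually_elim auto
  then obtain \<delta>0 where \<delta>0: "\<delta>0 > 0" "\<And>z. z \<noteq> 0 \<Longrightarrow> norm z < \<delta>0 \<Longrightarrow>
      P analytic_on {z} \<and> x z \<noteq> 1/4 \<and> m z \<noteq> 0 \<and> Re (q z) > 0 \<and> norm (Y z) < \<rho>"
    unfolding eventually_at by (auto simp: dist_norm)
  define \<delta> where "\<delta> = min \<delta>0 (min \<rho> r)"
  have \<delta>: "\<delta> > 0" using \<delta>0(1) \<rho> germ by (simp add: \<delta>_def elliptic_germ_def)
  have ode: "(Y has_field_derivative q z) (at z)" "(q z)\<^sup>2 = 1 - (Y z)\<^sup>2 + c * Y z ^ 4"
     "P z = (1 + q z) / (2 * (Y z)\<^sup>2) - 1/12" "Re (q z) > 0" "norm (Y z) < \<rho>"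
    if "z \<noteq> 0" "norm z < \<delta>" for z
  proof -
    have h: "P analytic_on {z}" "x z \<noteq> 1/4" "m z \<noteq> 0" and rest: "Re (q z) > 0" "norm (Y z) < \<rho>"
      using \<delta>0(2)[of z] that by (auto simp: \<delta>_def)
    have "4 * x z - 1 \<noteq> 0" using h(2) by (auto simp: field_simps)
    note o = weierstrass_to_elliptic_ode[OF W h(1) x_def m_def this h(3) q_def, folded Y_def]
    show "(Y has_field_derivative q z) (at z)" "(q z)\<^sup>2 = 1 - (Y z)\<^sup>2 + c * Y z ^ 4"
     "P z = (1 + q z) / (2 * (Y z)\<^sup>2) - 1/12" "Re (q z) > 0" "norm (Y z) < \<rho>"
      using o(1,2,4) rest by auto
  qed
  \<comment> \<open>At the pole \<open>deriv P\<close> has an arbitrary value, so \<open>Y\<close> itself need not be continuous at \<open>0\<close>.\<close>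
  define Z where "Z z = (if z = 0 then 0 else Y z)" for z
  have Zeq: "Z z = Y z" if "z \<in> - {0}" for z using that by (simp add: Z_def)
  have dZ: "(Z has_field_derivative q z) (at z)" if "z \<noteq> 0" "norm z < \<delta>" for z
    by (rule has_field_derivative_transform_within_open[OF ode(1)[OF that], of "- {0}"])
       (use that Zeq in auto)
  have contZ: "isCont Z z" if "norm z < \<delta>" for z
  proof (cases "z = 0")
    case True
    have "(Z \<longlongrightarrow> 0) (at 0)" using Y0
      by (rule Lim_transform_eventually) (auto simp: eventually_at_filter Z_def)
    thus ?thesis using True by (simp add: isCont_def Z_def)
  next
    case False
    thus ?thesis using DERIV_isCont[OF dZ] that by blast
  qed
  have eq: "Y z = y z" if z: "z \<noteq> 0" "norm z < \<delta>" for z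
  proof -
    have small: "norm (of_real t * z) < \<delta>" if "t \<in> {0..1}" for t
    proof -
      have "\<bar>t\<bar> * norm z \<le> 1 * norm z" using that by (intro mult_right_mono) auto
      thus ?thesis using z(2) by (simp add: norm_mult)
    qed
    have "Z (of_real 1 * z) = y z"
    proof (rule uniq[where \<gamma> = "\<lambda>t. Z (of_real t * z)" and \<pi> = "\<lambda>t. q (of_real t * z)"])
      show "norm z < \<rho>" using z by (simp add: \<delta>_def)
      show "continuous_on {0..1} (\<lambda>t. Z (of_real t * z))"
      proof (rule continuous_at_imp_continuous_on, rule ballI)
        fix t :: real assume t: "t \<in> {0..1}"
        have "isCont (\<lambda>t. complex_of_real t * z) t" by (intro continuous_intros)
        from isCont_o2[OF this contZ[OF small[OF t]]]
        show "isCont (\<lambda>t. Z (of_real t * z)) t" .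
      qed
      show "Z (of_real 0 * z) = 0" by (simp add: Z_def)
      show "(\<lambda>t. Z (of_real t * z)) ` {0..1} \<subseteq> ball 0 \<rho>"
        using ode(5) small \<rho> by (auto simp: Z_def)
      fix t :: real assume t: "t \<in> {0<..<1}"
      have tz: "of_real t * z \<noteq> 0" "norm (of_real t * z) < \<delta>" using t z small[of t] by auto
      have "((\<lambda>t. of_real t * z) has_vector_derivative z) (at t)"
        by (auto intro!: derivative_eq_intros)
      from field_vector_diff_chain_at[OF this dZ[OF tz]]
      have "((\<lambda>t. Z (of_real t * z)) has_vector_derivative z * q (of_real t * z)) (at t)"
        by (simp add: o_def)
      thus "((\<lambda>t. Z (of_real t * z)) has_vector_derivative z * q (of_real t * z)) (at t) \<and>
         (q (of_real t * z))\<^sup>2 = 1 - (Z (of_real t * z))\<^sup>2 + c * Z (of_real t * z) ^ 4 \<and>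
         Re (q (of_real t * z)) > 0"
        using ode(2,4)[OF tz] tz(1) by (simp add: Z_def)
    qed
    thus ?thesis using z by (simp add: Z_def)
  qed
  have "eventually (\<lambda>z. z \<in> ball 0 \<delta> - {0}) (at (0::complex))"
    using \<delta> by (intro eventually_at_in_open) auto
  thus ?thesis
  proof eventually_elim
    case (elim z)
    hence z: "z \<noteq> 0" "norm z < \<delta>" by auto
    have "(y has_field_derivative q z) (at z)"
      by (rule has_field_derivative_transform_within_open[OF ode(1)[OF z], of "ball 0 \<delta> - {0}"])
         (use elim eq in auto)
    moreover have "(y has_field_derivative p z) (at z)"
      using germ z by (auto simp: elliptic_germ_def \<delta>_def)
    ultimately have "p z = q z" by (rule DERIV_unique[symmetric])
    thus ?case using eq[OF z] ode(3)[OF z] by (simp add: Y_def)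
  qed
qed

lemma elliptic_germ_power_factor:
  assumes germ: "elliptic_germ c r y p"
  obtains h \<delta> where "0 < \<delta>" "\<delta> \<le> r" "h holomorphic_on ball 0 \<delta>" "h 0 = 1"
    "\<forall>z\<in>ball 0 \<delta>. h z \<noteq> 0 \<and> y z = z * h z"
proof -
  have r: "r > 0" and y0: "y 0 = 0" and p0: "p 0 = 1"
    and dy: "\<forall>z\<in>ball 0 r. (y has_field_derivative p z) (at z)"
    using germ by (auto simp: elliptic_germ_def)
  have d: "deriv y 0 = 1" using DERIV_imp_deriv[OF bspec[OF dy, of 0]] r p0 by simp
  define h where "h z = (if z = 0 then deriv y 0 else (y z - y 0) / (z - 0))" for z
  have holh: "h holomorphic_on ball 0 r"
    unfolding h_def[abs_def] by (rule pole_lemma_open[OF elliptic_germ_holomorphic[OF germ] open_ball])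
  have "open (ball 0 r \<inter> h -` (- {0}))"
    using holomorphic_on_imp_continuous_on[OF holh] by (intro continuous_open_preimage) auto
  moreover have "0 \<in> ball 0 r \<inter> h -` (- {0})" using r d by (simp add: h_def)
  ultimately obtain \<delta> where \<delta>: "\<delta> > 0" "ball 0 \<delta> \<subseteq> ball 0 r \<inter> h -` (- {0})"
    using open_contains_ball by blast
  show ?thesis
  proof (rule that[of "min \<delta> r" h])
    show "h holomorphic_on ball 0 (min \<delta> r)" by (rule holomorphic_on_subset[OF holh]) auto
    have "h z \<noteq> 0" if "z \<in> ball 0 (min \<delta> r)" for z
      using subsetD[OF \<delta>(2), of z] that by auto
    moreover have "y z = z * h z" for z by (simp add: h_def y0)
    ultimately show "\<forall>z\<in>ball 0 (min \<delta> r). h z \<noteq> 0 \<and> y z = z * h z" by blast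
  qed (use \<delta> r d in \<open>auto simp: h_def\<close>)
qed

text \<open>
  The equation is checked on a punctured disc, where the function is an explicit expression in
  \<open>y\<close> and \<open>p\<close>, and spreads to the plane by the identity theorem. The simple zero of \<open>y\<close> produces the
  double pole.
\<close>

lemma weierstrass_p_exists:
  assumes germ: "elliptic_germ c r y p"
  obtains P where "is_weierstrass_p ((1 + 12 * c) / 12) ((1 - 36 * c) / 216) P"
proof -
  let ?g2 = "(1 + 12 * c) / 12" and ?g3 = "(1 - 36 * c) / 216"
  obtain Y where Y1: "Y nicely_meromorphic_on UNIV" and Y2: "\<forall>z\<in>ball 0 r. Y z = y z"
    by (rule elliptic_germ_extend[OF germ]) (rule that)
  note Y = Y1 Y2[rule_format]
  obtain h \<delta> where h': "0 < \<delta>" "\<delta> \<le> r" "h holomorphic_on ball 0 \<delta>" "h 0 = 1"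
    "\<forall>z\<in>ball 0 \<delta>. h z \<noteq> 0 \<and> y z = z * h z"
    by (rule elliptic_germ_power_factor[OF germ]) (rule that)
  have hz: "h z \<noteq> 0" "y z = z * h z" if "z \<in> ball 0 \<delta>" for z using h'(5) that by auto
  note h = h'(1-4) hz
  have g: "(y has_field_derivative p z) (at z)" "(p has_field_derivative 2 * c * y z ^ 3 - y z) (at z)"
       "(p z)\<^sup>2 = 1 - (y z)\<^sup>2 + c * y z ^ 4" if "z \<in> ball 0 \<delta>" for z
    using germ that h(2) by (auto simp: elliptic_germ_def)
  define P0 where "P0 z = (1 + deriv Y z) / (2 * (Y z)\<^sup>2) - 1/12" for z
  define P where "P = remove_sings P0"
  define Q where "Q z = (1 + p z) / (2 * (y z)\<^sup>2) - 1/12" for z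
  have "Y meromorphic_on UNIV" using Y(1) by (simp add: nicely_meromorphic_on_def)
  hence mero0: "P0 meromorphic_on UNIV" unfolding P0_def by (intro meromorphic_intros)
  hence nice: "P nicely_meromorphic_on UNIV"
    unfolding P_def by (rule remove_sings_nicely_meromorphic)
  hence mero: "P meromorphic_on UNIV" by (simp add: nicely_meromorphic_on_def)
  have ynz: "y z \<noteq> 0" if "z \<in> ball 0 \<delta> - {0}" for z using that h(5,6)[of z] by auto
  have op: "open (ball 0 \<delta> - {0 :: complex})" by auto
  have P0Q: "P0 z = Q z" if "z \<in> ball 0 \<delta> - {0}" for z
  proof -
    have z: "z \<in> ball 0 r" using that h(2) by auto
    have "deriv Y z = deriv y z"
      by (rule deriv_cong_ev[OF eventually_eq_nhds_ball[OF Y(2) z] refl])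
    also have "\<dots> = p z" using that by (intro DERIV_imp_deriv g) auto
    finally show ?thesis using Y(2)[OF z] by (simp add: P0_def Q_def)
  qed
  have dQ: "(Q has_field_derivative ((y z)\<^sup>2 - 2 - 2 * p z) / (2 * y z ^ 3)) (at z)"
    if z: "z \<in> ball 0 \<delta> - {0}" for z
  proof -
    have z': "z \<in> ball 0 \<delta>" using z by auto
    have "((\<lambda>z. (1 + p z) / (2 * (y z)\<^sup>2) - 1/12) has_field_derivative
       ((2 * c * y z ^ 3 - y z) * (2 * (y z)\<^sup>2) - (1 + p z) * (2 * (2 * y z * p z))) /
         ((2 * (y z)\<^sup>2) * (2 * (y z)\<^sup>2)) - 0) (at z)"
    proof (intro DERIV_diff DERIV_divide DERIV_const)
      show "((\<lambda>z. 1 + p z) has_field_derivative 2 * c * y z ^ 3 - y z) (at z)"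
        by (rule derivative_eq_intros g(2)[OF z'] refl)+ simp
      show "((\<lambda>z. 2 * (y z)\<^sup>2) has_field_derivative 2 * (2 * y z * p z)) (at z)"
        by (rule derivative_eq_intros g(1)[OF z'] refl)+ simp
    qed (use ynz[OF z] in auto)
    moreover have "((2 * c * y z ^ 3 - y z) * (2 * (y z)\<^sup>2) - (1 + p z) * (2 * (2 * y z * p z))) =
        2 * y z * ((y z)\<^sup>2 - 2 - 2 * p z)"
      using g(3)[OF z'] by algebra
    moreover have "2 * y z * ((y z)\<^sup>2 - 2 - 2 * p z) / ((2 * (y z)\<^sup>2) * (2 * (y z)\<^sup>2)) =
       ((y z)\<^sup>2 - 2 - 2 * p z) / (2 * y z ^ 3)"
    proof -
      have nz: "(2 * (y z)\<^sup>2) * (2 * (y z)\<^sup>2) \<noteq> 0" "2 * y z ^ 3 \<noteq> 0" using ynz[OF z] by auto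
      show ?thesis unfolding frac_eq_eq[OF nz] by algebra
    qed
    ultimately show ?thesis unfolding Q_def[abs_def] by (simp only: diff_zero)
  qed
  have Qode: "(deriv Q z)\<^sup>2 = 4 * Q z ^ 3 - ?g2 * Q z - ?g3" if z: "z \<in> ball 0 \<delta> - {0}" for z
  proof -
    define x where "x = (1 + p z) / (2 * (y z)\<^sup>2)"
    have z': "z \<in> ball 0 \<delta>" using z by auto
    have xy: "2 * (y z)\<^sup>2 * x = 1 + p z" using ynz[OF z] by (simp add: x_def)
    have dd: "2 * y z ^ 3 * deriv Q z = (y z)\<^sup>2 - 2 - 2 * p z"
      using DERIV_imp_deriv[OF dQ[OF z]] ynz[OF z] by simp
    have "4 * y z ^ 6 * ((deriv Q z)\<^sup>2 - (4 * x - 1) * (x\<^sup>2 - c / 4)) = 0"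
      using xy dd g(3)[OF z'] by algebra
    hence "(deriv Q z)\<^sup>2 = (4 * x - 1) * (x\<^sup>2 - c / 4)" using ynz[OF z] by simp
    moreover have "Q z = x - 1/12" by (simp add: Q_def x_def)
    ultimately show ?thesis by (simp only: weierstrass_cubic_factor)
  qed
  have PQ: "P z = Q z" if z: "z \<in> ball 0 \<delta> - {0}" for z
  proof -
    have "Q holomorphic_on ball 0 \<delta> - {0}"
      unfolding holomorphic_on_open[OF op] using dQ by blast
    hence "Q analytic_on {z}" using op z analytic_at by blast
    have "eventually (\<lambda>w. P0 w = Q w) (at z)"
      using eventually_at_in_open'[OF op z] by eventually_elim (rule P0Q)
    hence "P z = remove_sings Q z" unfolding P_def by (rule remove_sings_cong) simp
    also have "\<dots> = Q z" using \<open>Q analytic_on {z}\<close> by (rule remove_sings_at_analytic)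
    finally show ?thesis .
  qed
  have dPQ: "deriv P z = deriv Q z" if z: "z \<in> ball 0 \<delta> - {0}" for z
  proof (rule deriv_cong_ev)
    show "eventually (\<lambda>w. P w = Q w) (nhds z)"
      using eventually_nhds_in_open[OF op z] by eventually_elim (rule PQ)
  qed simp
  have near0: "eventually (\<lambda>z. z \<in> ball 0 \<delta> - {0}) (at (0::complex))"
    using h(1) by (intro eventually_at_in_open) auto
  have ev: "eventually (\<lambda>w. (deriv P w)\<^sup>2 = 4 * P w ^ 3 - ?g2 * P w - ?g3) (at z)" for z
  proof (rule meromorphic_eq_propagate[where S = UNIV and ?z0.0 = 0])
    show "(\<lambda>w. (deriv P w)\<^sup>2) meromorphic_on UNIV"
      "(\<lambda>w. 4 * P w ^ 3 - ?g2 * P w - ?g3) meromorphic_on UNIV"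
      using mero by (intro meromorphic_intros; simp)+
    show "\<forall>\<^sub>F w in at 0. (deriv P w)\<^sup>2 = 4 * P w ^ 3 - ?g2 * P w - ?g3"
      using near0 by eventually_elim (simp only: PQ dPQ Qode)
  qed auto
  have ode: "(deriv P z)\<^sup>2 = 4 * P z ^ 3 - ?g2 * P z - ?g3" if "\<not> is_pole P z" for z
  proof -
    have an: "P analytic_on {z}"
      by (rule nicely_meromorphic_on_imp_analytic_at[OF nice UNIV_I that])
    have lims: "P \<midarrow>z\<rightarrow> P z" "deriv P \<midarrow>z\<rightarrow> deriv P z"
      using analytic_at_imp_isCont[OF an] analytic_at_imp_isCont[OF analytic_deriv[OF an]]
      by (auto simp: isCont_def)
    have "(\<lambda>w. (deriv P w)\<^sup>2) \<midarrow>z\<rightarrow> (deriv P z)\<^sup>2"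
      "(\<lambda>w. 4 * P w ^ 3 - ?g2 * P w - ?g3) \<midarrow>z\<rightarrow> 4 * P z ^ 3 - ?g2 * P z - ?g3"
      by (intro tendsto_intros lims)+
    thus ?thesis using tendsto_cong[OF ev] LIM_unique by blast
  qed
  \<comment> \<open>\<open>G\<close> is \<open>z\<^sup>2 P(z)\<close>, with the singularity at \<open>0\<close> removed.\<close>
  define G where "G z = (1 + p z) / (2 * (h z)\<^sup>2) - z\<^sup>2 / 12" for z
  have "p holomorphic_on ball 0 \<delta>"
    unfolding holomorphic_on_open[OF open_ball] using g(2) by blast
  hence holG: "G holomorphic_on ball 0 \<delta>"
    unfolding G_def using h(3,5) by (intro holomorphic_intros) auto
  have "p 0 = 1" using germ by (simp add: elliptic_germ_def)
  hence G0: "G 0 \<noteq> 0" by (simp add: G_def h(4))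
  have PG: "P w = G w * (w - 0) powi (- 2)" if w: "w \<in> ball 0 \<delta>" "w \<noteq> 0" for w
  proof -
    have "P w = Q w" using w by (intro PQ) auto
    also have "\<dots> = ((1 + p w) / (2 * (h w)\<^sup>2) - w\<^sup>2 / 12) * (w - 0) powi (- 2)"
      unfolding Q_def h(6)[OF w(1)] using w h(5)[OF w(1)]
      by (simp add: power_int_minus power_mult_distrib field_simps)
    finally show ?thesis by (simp only: G_def)
  qed
  have zo: "zorder P 0 = -2"
    by (rule zorder_eqI[where S = "ball 0 \<delta>" and g = G]) (use h(1) holG G0 PG in auto)
  have "G \<midarrow>0\<rightarrow> G 0"
    using holomorphic_on_imp_continuous_on[OF holG] h(1)
    by (simp add: continuous_on_eq_continuous_at isCont_def)
  hence "eventually (\<lambda>z. G z \<noteq> 0) (at 0)" using G0 by (rule tendsto_imp_eventually_ne)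
  hence "eventually (\<lambda>z. P z \<noteq> 0) (at 0)"
    using near0 by eventually_elim (auto simp: PG)
  hence "is_pole P 0"
    using zorder_neg_imp_is_pole[of P 0] meromorphic_on_subset[OF mero subset_UNIV] zo by simp
  thus ?thesis
    using that[of P] nice ode zo by (auto simp: is_weierstrass_p_def)
qed

text \<open>
  Uniqueness, which gives the definite description its meaning: two candidates are equal
  to the same expression in the local solution near \<open>0\<close>.
\<close>

lemma weierstrass_p_is_weierstrass_p:
  "is_weierstrass_p ((1 + 12 * c) / 12) ((1 - 36 * c) / 216)
     (weierstrass_p ((1 + 12 * c) / 12) ((1 - 36 * c) / 216))"
proof -
  let ?W = "is_weierstrass_p ((1 + 12 * c) / 12) ((1 - 36 * c) / 216)"
  obtain r y p where germ: "elliptic_germ c r y p" using elliptic_germ_exists by blast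
  obtain P where P: "?W P" using weierstrass_p_exists[OF germ] by blast
  have "P' = P" if P': "?W P'" for P'
  proof
    fix z
    have "eventually (\<lambda>z. P' z = P z) (at 0)"
      using weierstrass_to_elliptic_eq_germ[OF P' germ] weierstrass_to_elliptic_eq_germ[OF P germ]
      by eventually_elim simp
    moreover have "P' nicely_meromorphic_on UNIV" "P nicely_meromorphic_on UNIV"
      using P P' by (auto simp: is_weierstrass_p_def)
    ultimately show "P' z = P z"
      by (intro nicely_meromorphic_eq_propagate[of P' UNIV P 0 z]) auto
  qed
  with P show ?thesis unfolding weierstrass_p_def by (rule theI)
qed

theorem theorem4:
  fixes \<kappa> :: real
  assumes "0 < \<kappa>" and "\<kappa> < 1"
  shows
    "let k = complex_of_real \<kappa>;
         G2 = 1/12 * (1 + 3 * k\<^sup>2);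
         G3 = 1/216 * (1 - 9 * k\<^sup>2);
         P = weierstrass_p G2 G3;
         f = (\<lambda>z. (k/4 * deriv P z) / ((k/4)\<^sup>2 - (1/12 + P z)\<^sup>2));
         g = (\<lambda>z. (k/4 * deriv P z) / ((k/4 - 1/12 - P z) * (k/4 + 1/12 + P z)))
     in f meromorphic_on UNIV \<and> g meromorphic_on UNIV \<and>
        (\<forall>u::real.
           \<not> is_pole f (of_real u) \<and> \<not> is_pole g (of_real u) \<and>
           complex_of_real (rn2 \<kappa> u) = remove_sings f (of_real u)) \<and>
        (\<forall>z. remove_sings f z = remove_sings g z)"
proof -
  define k where "k = complex_of_real \<kappa>"
  define c where "c = complex_of_real (\<kappa>\<^sup>2 / 4)"
  define P where "P = weierstrass_p (1/12 * (1 + 3 * k\<^sup>2)) (1/216 * (1 - 9 * k\<^sup>2))"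
  define f where "f = (\<lambda>z. (k/4 * deriv P z) / ((k/4)\<^sup>2 - (1/12 + P z)\<^sup>2))"
  define g where "g = (\<lambda>z. (k/4 * deriv P z) / ((k/4 - 1/12 - P z) * (k/4 + 1/12 + P z)))"
  have fg: "g = f"
    by (rule ext) (simp add: f_def g_def power2_eq_square algebra_simps)
  have invariants: "1/12 * (1 + 3 * k\<^sup>2) = (1 + 12 * c) / 12" "1/216 * (1 - 9 * k\<^sup>2) = (1 - 36 * c) / 216"
    by (simp_all add: k_def c_def)
  have W: "is_weierstrass_p ((1 + 12 * c) / 12) ((1 - 36 * c) / 216) P"
    unfolding P_def invariants by (rule weierstrass_p_is_weierstrass_p)
  hence "P meromorphic_on UNIV"
    by (simp add: is_weierstrass_p_def nicely_meromorphic_on_def)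
  hence mero: "f meromorphic_on UNIV" unfolding f_def by (intro meromorphic_intros)
  obtain r y p where germ: "elliptic_germ c r y p" using elliptic_germ_exists by blast
  obtain Y where Y1: "Y nicely_meromorphic_on UNIV" and Y2: "\<forall>z\<in>ball 0 r. Y z = y z"
    by (rule elliptic_germ_extend[OF germ]) (rule that)
  note Y = Y1 Y2[rule_format]
  have "r > 0" using germ by (simp add: elliptic_germ_def)
  hence "eventually (\<lambda>z. z \<in> ball 0 r) (at 0)" by (intro eventually_at_in_open') auto
  hence near0: "eventually (\<lambda>z. f z = k / 2 * Y z) (at 0)"
    using weierstrass_to_elliptic_eq_germ[OF W germ]
  proof eventually_elim
    case (elim z)
    have "(k/4)\<^sup>2 - (1/12 + P z)\<^sup>2 = - ((P z + 1/12)\<^sup>2 - c / 4)"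
      by (simp add: k_def c_def power2_eq_square algebra_simps)
    moreover have "k / 4 * d / (- M) = k / 2 * (- d / (2 * M))" for d M :: complex
      by (cases "M = 0") (auto simp: field_simps)
    ultimately have "f z = k / 2 * weierstrass_to_elliptic c P z"
      by (simp only: f_def weierstrass_to_elliptic_def)
    thus ?case using elim Y(2) by simp
  qed
  have meroY: "(\<lambda>z. k / 2 * Y z) meromorphic_on UNIV"
    using Y(1) unfolding nicely_meromorphic_on_def by (intro meromorphic_intros) auto
  have real: "\<not> is_pole f (of_real u) \<and> complex_of_real (rn2 \<kappa> u) = remove_sings f (of_real u)" for u
  proof -
    note rn2 = rn2_eq_extension[OF assms germ[unfolded c_def] Y1 Y2, of u]
    have ev: "eventually (\<lambda>z. f z = k / 2 * Y z) (at (of_real u))"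
      by (rule meromorphic_eq_propagate[OF mero meroY open_UNIV connected_UNIV UNIV_I near0 UNIV_I])
    have an: "(\<lambda>z. k / 2 * Y z) analytic_on {of_real u}"
      using rn2(1) by (intro analytic_intros)
    have "remove_sings f (of_real u) = k / 2 * Y (of_real u)"
      using remove_sings_cong[OF ev refl] remove_sings_at_analytic[OF an] by simp
    also have "\<dots> = of_real (rn2 \<kappa> u)"
      using assms(1) by (simp add: rn2(2) k_def)
    finally have "complex_of_real (rn2 \<kappa> u) = remove_sings f (of_real u)" ..
    moreover have "\<not> is_pole f (of_real u)"
      unfolding is_pole_cong[OF ev refl]
      using analytic_at_imp_no_pole[OF an] .
    ultimately show ?thesis by blast
  qed
  show ?thesis
    unfolding Let_def k_def[symmetric] P_def[symmetric] f_def[symmetric] g_def[symmetric]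
    unfolding fg using mero real by blast
qed

end
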